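(* There is an absolute constant $c_2$ with the following property. Let $S \subset \mathbb{R}^D$ be a finite data set and build an RPTree-Max on $S$. Let $C$ be any cell of the tree such that $S \cap C$ has doubling dimension at most $d$. Then for any $s \geq 2$, with probability at least $1 - 1/4$ (over the randomization in constructing the subtree rooted at $C$), every descendant $C'$ of $C$ which is more than $c_2 \cdot s \cdot d \log d$ levels below $C$ satisfies $\mathrm{radius}(C') \leq \mathrm{radius}(C)/s$.
   Context: Doubling dimension: the doubling dimension of a set $T \subset \mathbb{R}^D$ is the smallest integer $d$ such that for every closed ball $B(x,r) \subset \mathbb{R}^D$, the set $B(x,r) \cap T$ can be covered by $2^d$ balls of radius $r/2$. RPTree-Max: a random binary tree of cells built recursively on a finite data set $S \subset \mathbb{R}^D$; the root cell contains all of $S$. A cell $C$ (containing data $S\cap C$) is split as follows: pick an arbitrary point $x \in S \cap C$ and set $\tilde\Delta = \max\{\|x-y\| : y \in S\cap C\}$; choose a random direction $v \sim N(0,(1/D) I_D)$; independently choose $\delta$ uniformly at random in $[-6\tilde\Delta/\sqrt{D},\, 6\tilde\Delta/\sqrt{D}]$; a point $y \in S \cap C$ goes to the left child if $y\cdot v < \mathrm{median}\{z \cdot v : z \in S \cap C\} + \delta$ and to the right child otherwise. Random choices at different splits are independent. $\mathrm{radius}(C)$ denotes the radius of the cell, i.e. the radius of the smallest ball containing the data $S \cap C$.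
   Formalization: The bound d is assumed to be at least 2: for d = 1 the level bound d log d is 0 and the claim fails (two points on a line are rarely separated by one split), and for d = 0 the logarithm is undefined; data of doubling dimension 0 or 1 is covered by taking d = 2. *)

theory Defs
  imports "HOL-Probability.Probability" "HOL-Library.Sublist"
begin

text \<open>
  The dimension \<open>D\<close> is a term rather than a type, so that one constant can serve all dimensions:
  a point of \<open>D\<close>-dimensional Euclidean space is a function that is \<open>undefined\<close> outside \<open>{..<D}\<close>.
  This is also the underlying space of the product measure \<open>gaussian D\<close> below.
\<close>

type_synonym vec = "nat \<Rightarrow> real"

definition vecs :: "nat \<Rightarrow> vec set" where
  "vecs D = {..<D} \<rightarrow>\<^sub>E UNIV"

definition vdist :: "nat \<Rightarrow> vec \<Rightarrow> vec \<Rightarrow> real" where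
  "vdist D x y = L2_set (\<lambda>i. x i - y i) {..<D}"

definition vinner :: "nat \<Rightarrow> vec \<Rightarrow> vec \<Rightarrow> real" where
  "vinner D x y = (\<Sum>i<D. x i * y i)"

definition vball :: "nat \<Rightarrow> vec \<Rightarrow> real \<Rightarrow> vec set" where
  "vball D x r = {y \<in> vecs D. vdist D x y \<le> r}"

definition doubling_dim :: "nat \<Rightarrow> vec set \<Rightarrow> nat" where
  "doubling_dim D T = (LEAST d. \<forall>x\<in>vecs D. \<forall>r>0.
     \<exists>A\<subseteq>vecs D. finite A \<and> card A \<le> 2 ^ d \<and> vball D x r \<inter> T \<subseteq> (\<Union>a\<in>A. vball D a (r / 2)))"

text \<open>The infimum is attained for bounded \<open>T\<close>; the empty set gets radius \<open>0\<close>.\<close>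

definition radius :: "nat \<Rightarrow> vec set \<Rightarrow> real" where
  "radius D T = Inf {r. 0 \<le> r \<and> (\<exists>c\<in>vecs D. T \<subseteq> vball D c r)}"

text \<open>For an even number of elements this is the mean of the two middle ones.\<close>

definition median :: "real multiset \<Rightarrow> real" where
  "median M = (let xs = sorted_list_of_multiset M; n = size M
     in (xs ! ((n - 1) div 2) + xs ! (n div 2)) / 2)"

text \<open>The distribution \<open>N(0, (1/D) I)\<close>; the second argument of \<^const>\<open>normal_density\<close> is the
  standard deviation.\<close>

definition gaussian :: "nat \<Rightarrow> vec measure" where
  "gaussian D = Pi\<^sub>M {..<D} (\<lambda>_. density lborel (normal_density 0 (1 / sqrt (real D))))"

text \<open>
  The randomness of a single split is a pair \<open>(v, u)\<close> with \<open>u\<close> uniform on \<open>[-1, 1]\<close>. The offset of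
  the split point is \<open>u * 6 * \<Delta> / sqrt D\<close>, which is uniform on
  \<open>[- 6 * \<Delta> / sqrt D, 6 * \<Delta> / sqrt D]\<close> and independent of \<open>v\<close>.
\<close>

type_synonym noise = "vec \<times> real"

definition split_noise :: "nat \<Rightarrow> noise measure" where
  "split_noise D = gaussian D \<Otimes>\<^sub>M uniform_measure lborel {-1..1}"

text \<open>
  A cell is represented by the data points it contains. In the following definition, \<open>x\<close> is the
  point picked in the cell \<open>T\<close>; the result is the left child (\<open>True\<close>) or the right child (\<open>False\<close>).
\<close>

definition split_cell :: "nat \<Rightarrow> vec set \<Rightarrow> vec \<Rightarrow> noise \<Rightarrow> bool \<Rightarrow> vec set" where
  "split_cell D T x = (\<lambda>(v, u) left.
     let \<Delta> = Max ((\<lambda>y. vdist D x y) ` T);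
         \<delta> = u * (6 * \<Delta> / sqrt (real D));
         t = median (image_mset (\<lambda>z. vinner D z v) (mset_set T)) + \<delta>
     in {y \<in> T. vinner D y v < t \<longleftrightarrow> left})"

text \<open>
  A node of the tree is addressed by the sequence of turns leading to it, the last turn first. So
  the ancestors of \<open>p\<close> are the suffixes of \<open>p\<close>, and a node \<open>k\<close> levels below \<open>q\<close> has the form
  \<open>p @ q\<close> with \<open>length p = k\<close>. No branch is ever cut off: below an empty cell all cells are empty.
\<close>

type_synonym node = "bool list"

definition subtree :: "node \<Rightarrow> node set" where
  "subtree q = {p. suffix q p}"

definition tree_noise :: "nat \<Rightarrow> node set \<Rightarrow> (node \<Rightarrow> noise) measure" where
  "tree_noise D N = Pi\<^sub>M N (\<lambda>_. split_noise D)"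

text \<open>
  The choice of a point in each cell may depend on the node, on the data in the cell and, measurably,
  on the outcome of the splits at all proper ancestors, but not on the randomness drawn later.
\<close>

type_synonym pick_rule = "node \<Rightarrow> (node \<Rightarrow> noise) \<Rightarrow> vec set \<Rightarrow> vec"

definition proper_ancestors :: "node \<Rightarrow> node set" where
  "proper_ancestors p = {a. strict_suffix a p}"

definition valid_pick :: "nat \<Rightarrow> vec set \<Rightarrow> pick_rule \<Rightarrow> bool" where
  "valid_pick D S pick \<longleftrightarrow> (\<forall>p T. T \<subseteq> S \<and> T \<noteq> {} \<longrightarrow>
     (\<lambda>h. pick p h T) \<in> measurable (tree_noise D (proper_ancestors p)) (count_space T))"

primrec cell :: "nat \<Rightarrow> vec set \<Rightarrow> pick_rule \<Rightarrow> (node \<Rightarrow> noise) \<Rightarrow> node \<Rightarrow> vec set" where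
  "cell D S pick \<omega> [] = S"
| "cell D S pick \<omega> (b # p) =
     (let T = cell D S pick \<omega> p
      in split_cell D T (pick p (restrict \<omega> (proper_ancestors p)) T) (\<omega> p) b)"

end

theory Submission imports Defs begin

text \<open>
  Cover the data of \<open>C\<close> by balls that are smaller than the target distance \<open>\<rho>\<close> by a factor of order
  \<open>d\<close>, and consider two balls whose centres are about \<open>\<rho>\<close> apart. Given the direction \<open>v\<close>, the
  threshold of a split is uniform on a window around the median, so the expected number of children
  that still meet both balls is \<open>1\<close> plus the normalised length of (overlap minus gap) of the two
  projected clusters. The clusters have expected width of order \<open>\<rho> / sqrt D\<close> with a small constant by
  chaining, whereas the projected distance is of order \<open>\<rho> / sqrt D\<close> and by Chebyshev the window
  usually contains both clusters. Hence one split multiplies the expected number of cells meeting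
  both balls by at most \<open>1 - \<rho> / (1440 R)\<close>, where \<open>R\<close> bounds the diameter of the cell, and never
  increases it.

  A union bound over all pairs of balls costs a factor \<open>exp (O (d * ln (s * d)))\<close>. Going from
  radius \<open>\<Delta>\<close> to \<open>\<Delta> / s\<close> at once would take \<open>s * d * ln (s * d)\<close> levels; passing through the
  intermediate scale \<open>\<Delta> / sqrt s\<close> takes two stages of \<open>sqrt s * d * ln (s * d)\<close> levels each, which
  is \<open>O (s * d * ln d)\<close>.
\<close>

section \<open>Distances, radii and coverings\<close>

text \<open>A cell of diameter above \<open>\<rho>\<close> meets two covering balls with distant
  centres, so excluding all such pairs at one level bounds every diameter there and below. For one
  pair a first moment suffices: a left child meets both clusters only if the threshold exceeds both
  lower ends, a right child only if it is at most both upper ends. For a uniform threshold the two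
  probabilities add up to at most \<open>1\<close> plus a difference of two distribution values. Two
  obstacles shape the rest. The median depends on the same \<open>v\<close> as the projections, so
  nothing is computed about its law; it is only shown to lie near the projection of the picked
  point, by second moments. And cells and picks are adaptive; as \<open>S\<close> is finite, each
  step is decomposed over the finitely many values of cell and pick, after which the noise of the
  next split is fresh. The intermediate scale pays off because a stage of ratio
  \<open>sqrt s\<close> costs only a factor \<open>sqrt s\<close> in levels, and
  \<open>sqrt s * ln s\<close> is \<open>O(s)\<close>.\<close>

lemma vdist_commute: "vdist D x y = vdist D y x"
  by (simp add: vdist_def L2_set_def power2_commute)

lemma vdist_nonneg [simp]: "0 \<le> vdist D x y"
  by (simp add: vdist_def)

lemma vdist_self [simp]: "vdist D x x = 0"
  by (simp add: vdist_def L2_set_def)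

lemma vdist_triangle: "vdist D x z \<le> vdist D x y + vdist D y z"
  using L2_set_triangle_ineq[of "\<lambda>i. x i - y i" "\<lambda>i. y i - z i" "{..<D}"]
  by (simp add: vdist_def)

lemma mem_vball: "y \<in> vball D x r \<longleftrightarrow> y \<in> vecs D \<and> vdist D x y \<le> r"
  by (simp add: vball_def)

lemma vecs_nonempty: "vecs D \<noteq> {}"
  by (simp add: vecs_def PiE_eq_empty_iff)

lemma finite_subset_vball:
  assumes "finite T" "T \<subseteq> vecs D" "c \<in> vecs D"
  obtains r where "0 \<le> r" "T \<subseteq> vball D c r"
proof
  show "0 \<le> (\<Sum>y\<in>T. vdist D c y)" by (simp add: sum_nonneg)
  show "T \<subseteq> vball D c (\<Sum>y\<in>T. vdist D c y)"
    using assms by (auto simp: mem_vball intro!: member_le_sum)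
qed

lemma radius_set_nonempty:
  assumes "finite T" "T \<subseteq> vecs D"
  shows "{r. 0 \<le> r \<and> (\<exists>c\<in>vecs D. T \<subseteq> vball D c r)} \<noteq> {}"
proof -
  obtain c where c: "c \<in> vecs D" using vecs_nonempty by blast
  obtain r where "0 \<le> r" "T \<subseteq> vball D c r" using finite_subset_vball[OF assms c] .
  then show ?thesis using c by auto
qed

lemma radius_set_bdd_below: "bdd_below {r::real. 0 \<le> r \<and> P r}"
  by (rule bdd_belowI[of _ 0]) auto

lemma radius_nonneg:
  assumes "finite T" "T \<subseteq> vecs D"
  shows "0 \<le> radius D T"
  unfolding radius_def using radius_set_nonempty[OF assms] by (intro cInf_greatest) auto

lemma radius_mono:
  assumes "finite T" "T \<subseteq> vecs D" "T' \<subseteq> T"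
  shows "radius D T' \<le> radius D T"
  unfolding radius_def
proof (rule cInf_superset_mono[OF radius_set_nonempty[OF assms(1,2)] radius_set_bdd_below])
  show "{r. 0 \<le> r \<and> (\<exists>c\<in>vecs D. T \<subseteq> vball D c r)} \<subseteq> {r. 0 \<le> r \<and> (\<exists>c\<in>vecs D. T' \<subseteq> vball D c r)}"
    using assms(3) by blast
qed

lemma radius_le:
  assumes "c \<in> vecs D" "0 \<le> r" "T \<subseteq> vball D c r"
  shows "radius D T \<le> r"
  unfolding radius_def by (rule cInf_lower[OF _ radius_set_bdd_below]) (use assms in blast)

lemma radius_lessD:
  assumes "finite T" "T \<subseteq> vecs D" "radius D T < r"
  obtains c where "c \<in> vecs D" "T \<subseteq> vball D c r"
proof -
  obtain r' c where *: "r' < r" "c \<in> vecs D" "T \<subseteq> vball D c r'"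
    using cInf_lessD[OF radius_set_nonempty[OF assms(1,2)], of r] assms(3) unfolding radius_def by auto
  then have "vball D c r' \<subseteq> vball D c r" by (auto simp: vball_def)
  then show ?thesis using that[OF *(2)] *(3) by blast
qed

text \<open>Pairs of far points are what the two-ball argument excludes, so diameters replace radii
  inside the proof. A bound as a predicate needs no supremum and passes to subsets; the conversions
  cost only a constant factor.\<close>

definition diam_le :: "nat \<Rightarrow> vec set \<Rightarrow> real \<Rightarrow> bool" where
  "diam_le D T R \<longleftrightarrow> (\<forall>y\<in>T. \<forall>z\<in>T. vdist D y z \<le> R)"

lemma diam_le_subset: "diam_le D T R \<Longrightarrow> T' \<subseteq> T \<Longrightarrow> diam_le D T' R"
  unfolding diam_le_def by blast

lemma radius_le_diam:
  assumes "T \<subseteq> vecs D" "diam_le D T R" "0 \<le> R"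
  shows "radius D T \<le> R"
proof (cases "T = {}")
  case True
  then show ?thesis using vecs_nonempty[of D] assms(3) by (auto intro: radius_le)
next
  case False
  then obtain x where "x \<in> T" by blast
  then show ?thesis using assms by (intro radius_le[of x]) (auto simp: mem_vball diam_le_def)
qed

lemma diam_le_vball:
  assumes "T \<subseteq> vball D c r"
  shows "diam_le D T (2 * r)"
  unfolding diam_le_def
proof (intro ballI)
  fix y z assume "y \<in> T" "z \<in> T"
  then have "vdist D c y \<le> r" "vdist D c z \<le> r" using assms by (auto simp: mem_vball)
  then show "vdist D y z \<le> 2 * r" using vdist_triangle[of D y z c] vdist_commute[of D y c] by linarith
qed

section \<open>Doubling sets and covers at all scales\<close>

definition doubling :: "nat \<Rightarrow> vec set \<Rightarrow> nat \<Rightarrow> bool" where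
  "doubling D T d \<longleftrightarrow> (\<forall>x\<in>vecs D. \<forall>r>0.
     \<exists>A\<subseteq>vecs D. finite A \<and> card A \<le> 2 ^ d \<and> vball D x r \<inter> T \<subseteq> (\<Union>a\<in>A. vball D a (r / 2)))"

lemma doublingD:
  assumes "doubling D T d" "x \<in> vecs D" "0 < r"
  obtains A where "A \<subseteq> vecs D" "finite A" "card A \<le> 2 ^ d" "vball D x r \<inter> T \<subseteq> (\<Union>a\<in>A. vball D a (r / 2))"
  using assms(1)[unfolded doubling_def, rule_format, OF assms(2,3)] by (elim exE conjE)

lemma doubling_mono:
  assumes "doubling D T d" "d \<le> d'"
  shows "doubling D T d'"
  unfolding doubling_def
proof (intro ballI allI impI)
  fix x and r :: real assume "x \<in> vecs D" "0 < r"
  with assms(1) obtain A where A: "A \<subseteq> vecs D" "finite A" "card A \<le> 2 ^ d"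
    "vball D x r \<inter> T \<subseteq> (\<Union>a\<in>A. vball D a (r / 2))" by (rule doublingD)
  have "(2::nat) ^ d \<le> 2 ^ d'" using assms(2) by simp
  then have "card A \<le> 2 ^ d'" using A(3) by linarith
  then show "\<exists>A\<subseteq>vecs D. finite A \<and> card A \<le> 2 ^ d' \<and> vball D x r \<inter> T \<subseteq> (\<Union>a\<in>A. vball D a (r / 2))"
    by (intro exI[of _ A] conjI A)
qed

text \<open>The \<open>LEAST\<close> in \<open>doubling_dim\<close> has meaning only if some
  exponent works. For a finite set \<open>card T\<close> does: balls around the points themselves
  cover it, and \<open>card T \<le> 2 ^ card T\<close>.\<close>

lemma doubling_of_dim_le:
  assumes "finite T" "T \<subseteq> vecs D" "doubling_dim D T \<le> d"
  shows "doubling D T d"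
proof -
  have "doubling D T (card T)"
    unfolding doubling_def
  proof (intro ballI allI impI)
    fix x and r :: real assume r: "0 < r"
    have "vball D x r \<inter> T \<subseteq> (\<Union>a\<in>T. vball D a (r / 2))"
    proof
      fix y assume "y \<in> vball D x r \<inter> T"
      then have "y \<in> T" "y \<in> vball D y (r / 2)" using r by (auto simp: mem_vball)
      then show "y \<in> (\<Union>a\<in>T. vball D a (r / 2))" by (metis UN_iff)
    qed
    moreover have "card T \<le> 2 ^ card T" using less_exp[of "card T"] by linarith
    ultimately show "\<exists>A\<subseteq>vecs D. finite A \<and> card A \<le> 2 ^ card T \<and> vball D x r \<inter> T \<subseteq> (\<Union>a\<in>A. vball D a (r / 2))"
      by (intro exI[of _ T] conjI assms)
  qed
  then have "doubling D T (LEAST d. doubling D T d)" by (rule LeastI)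
  moreover have "doubling_dim D T = (LEAST d. doubling D T d)"
    by (simp only: doubling_dim_def doubling_def)
  ultimately show ?thesis using doubling_mono assms(3) by metis
qed

text \<open>Each halving of the radius replaces a ball by at most \<open>2 ^ d\<close> balls, so
  \<open>m\<close> halvings multiply the count by \<open>2 ^ d\<close> each time.\<close>

lemma doubling_cover:
  assumes "doubling D T d" "z \<in> vecs D" "0 < r"
  shows "\<exists>A\<subseteq>vecs D. finite A \<and> card A \<le> 2 ^ (d * m) \<and> vball D z r \<inter> T \<subseteq> (\<Union>a\<in>A. vball D a (r / 2 ^ m))"
proof (induction m)
  case 0
  show ?case using assms by (intro exI[of _ "{z}"]) auto
next
  case (Suc m)
  then obtain A where A: "A \<subseteq> vecs D" "finite A" "card A \<le> 2 ^ (d * m)"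
    "vball D z r \<inter> T \<subseteq> (\<Union>a\<in>A. vball D a (r / 2 ^ m))" by blast
  have "\<forall>a\<in>A. \<exists>B\<subseteq>vecs D. finite B \<and> card B \<le> 2 ^ d \<and>
      vball D a (r / 2 ^ m) \<inter> T \<subseteq> (\<Union>b\<in>B. vball D b (r / 2 ^ m / 2))"
  proof
    fix a assume "a \<in> A"
    then have "a \<in> vecs D" "0 < r / 2 ^ m" using A(1) assms(3) by auto
    then show "\<exists>B\<subseteq>vecs D. finite B \<and> card B \<le> 2 ^ d \<and>
      vball D a (r / 2 ^ m) \<inter> T \<subseteq> (\<Union>b\<in>B. vball D b (r / 2 ^ m / 2))"
      by (rule assms(1)[unfolded doubling_def, rule_format])
  qed
  from bchoice[OF this] obtain B where B: "\<And>a. a \<in> A \<Longrightarrow> B a \<subseteq> vecs D" "\<And>a. a \<in> A \<Longrightarrow> finite (B a)"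
    "\<And>a. a \<in> A \<Longrightarrow> card (B a) \<le> 2 ^ d"
    "\<And>a. a \<in> A \<Longrightarrow> vball D a (r / 2 ^ m) \<inter> T \<subseteq> (\<Union>b\<in>B a. vball D b (r / 2 ^ m / 2))"
    by blast
  have "card (\<Union>a\<in>A. B a) \<le> (\<Sum>a\<in>A. card (B a))" using A(2) by (rule card_UN_le)
  also have "\<dots> \<le> card A * 2 ^ d" using sum_bounded_above[of A "\<lambda>a. card (B a)" "2 ^ d"] B(3) by simp
  also have "\<dots> \<le> 2 ^ (d * m) * 2 ^ d" using A(3) by simp
  also have "\<dots> = 2 ^ (d * Suc m)" by (simp add: power_add)
  finally have card: "card (\<Union>a\<in>A. B a) \<le> 2 ^ (d * Suc m)" .
  have "vball D z r \<inter> T \<subseteq> (\<Union>b\<in>(\<Union>a\<in>A. B a). vball D b (r / 2 ^ Suc m))"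
  proof
    fix y assume y: "y \<in> vball D z r \<inter> T"
    then obtain a where a: "a \<in> A" "y \<in> vball D a (r / 2 ^ m) \<inter> T" using A(4) by blast
    then obtain b where "b \<in> B a" "y \<in> vball D b (r / 2 ^ m / 2)" using B(4) by blast
    then show "y \<in> (\<Union>b\<in>(\<Union>a\<in>A. B a). vball D b (r / 2 ^ Suc m))" using a(1)
      by (auto simp: field_simps)
  qed
  then show ?case using card A(2) B(1,2) by (intro exI[of _ "\<Union>a\<in>A. B a"]) auto
qed

section \<open>Gaussian projections\<close>

text \<open>The joint law of the coordinates is the product measure itself, which is the product of
  its own marginals; this characterises independence.\<close>

lemma indep_vars_PiM_coordinate:
  assumes M: "\<And>i. i \<in> I \<Longrightarrow> prob_space (M i)" and "I \<noteq> {}"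
  shows "prob_space.indep_vars (PiM I M) M (\<lambda>i \<omega>. \<omega> i) I"
proof -
  interpret P: prob_space "PiM I M" using M by (rule prob_space_PiM)
  have "distr (PiM I M) (PiM I M) (\<lambda>\<omega>. \<lambda>i\<in>I. \<omega> i) = distr (PiM I M) (PiM I M) (\<lambda>\<omega>. \<omega>)"
    by (rule distr_cong) (auto simp: space_PiM PiE_restrict)
  also have "\<dots> = PiM I M" by (rule distr_id2) simp
  also have "\<dots> = PiM I (\<lambda>i. distr (PiM I M) (M i) (\<lambda>\<omega>. \<omega> i))"
    by (rule PiM_cong) (use M distr_PiM_component[of I M] in auto)
  finally show ?thesis
    by (subst P.indep_vars_iff_distr_eq_PiM'[OF \<open>I \<noteq> {}\<close>]) auto
qed

abbreviation coord_noise :: "nat \<Rightarrow> real measure" where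
  "coord_noise D \<equiv> density lborel (\<lambda>x. ennreal (normal_density 0 (1 / sqrt (real D)) x))"

lemma prob_space_coord_noise: "1 \<le> D \<Longrightarrow> prob_space (coord_noise D)"
  by (rule prob_space_normal_density) simp

lemma prob_space_gaussian: "1 \<le> D \<Longrightarrow> prob_space (gaussian D)"
  unfolding gaussian_def by (intro prob_space_PiM prob_space_coord_noise)

lemma coord_measurable [measurable]: "i < D \<Longrightarrow> (\<lambda>v. v i) \<in> borel_measurable (gaussian D)"
  using measurable_component_singleton[of i "{..<D}" "\<lambda>_. coord_noise D"]
  by (simp add: gaussian_def)

lemma vinner_measurable [measurable]: "(\<lambda>v. vinner D a v) \<in> borel_measurable (gaussian D)"
  unfolding vinner_def by measurable

lemma vinner_diff: "vinner D y v - vinner D z v = vinner D (\<lambda>i. y i - z i) v"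
  by (simp add: vinner_def sum_subtractf left_diff_distrib)

lemma gaussian_coord_distributed:
  assumes "1 \<le> D" "i < D"
  shows "distributed (gaussian D) lborel (\<lambda>v. v i) (normal_density 0 (1 / sqrt (real D)))"
proof -
  have "distr (gaussian D) lborel (\<lambda>v. v i) = distr (gaussian D) (coord_noise D) (\<lambda>v. v i)"
    by (rule distr_cong) auto
  also have "\<dots> = coord_noise D"
    unfolding gaussian_def using assms prob_space_coord_noise
    by (intro distr_PiM_component) auto
  finally show ?thesis using assms by (auto simp: distributed_def)
qed

lemma gaussian_vinner_distributed:
  assumes "1 \<le> D" "0 < L2_set a {..<D}"
  shows "distributed (gaussian D) lborel (\<lambda>v. vinner D a v) (normal_density 0 (L2_set a {..<D} / sqrt (real D)))"
proof -
  interpret prob_space "gaussian D" using assms(1) by (rule prob_space_gaussian)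
  \<comment> \<open>A normal variable scaled by \<open>0\<close> has no density, so vanishing
    coefficients are dropped before independent normals are summed.\<close>
  define I where "I = {i. i < D \<and> a i \<noteq> 0}"
  have fin: "finite I" and sub: "I \<subseteq> {..<D}" by (auto simp: I_def)
  have ne: "I \<noteq> {}" using assms(2) by (force simp: I_def L2_set_def)
  have "indep_vars (\<lambda>_. coord_noise D) (\<lambda>i v. v i) {..<D}"
    using assms(1) prob_space_coord_noise unfolding gaussian_def
    by (intro indep_vars_PiM_coordinate) (auto simp: lessThan_empty_iff)
  then have "indep_vars (\<lambda>_. coord_noise D) (\<lambda>i v. v i) I"
    using sub by (rule indep_vars_subset)
  then have indep: "indep_vars (\<lambda>_. borel) (\<lambda>i v. a i * v i) I"
    by (rule indep_vars_compose2) simp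
  have "distributed (gaussian D) lborel (\<lambda>v. a i * v i) (normal_density 0 (\<bar>a i\<bar> * (1 / sqrt (real D))))"
    if "i \<in> I" for i
    using normal_density_affine[OF gaussian_coord_distributed[of D i], of "a i" 0] that assms(1)
    by (simp add: I_def)
  then have "distributed (gaussian D) lborel (\<lambda>v. \<Sum>i\<in>I. a i * v i)
      (normal_density (\<Sum>i\<in>I. 0) (sqrt (\<Sum>i\<in>I. (\<bar>a i\<bar> * (1 / sqrt (real D)))\<^sup>2)))"
    using assms(1) by (intro sum_indep_normal fin ne indep) (auto simp: I_def)
  moreover have "(\<lambda>v. \<Sum>i\<in>I. a i * v i) = (\<lambda>v. vinner D a v)"
    unfolding vinner_def using sub by (intro ext sum.mono_neutral_left) (auto simp: I_def)
  moreover have "(\<Sum>i\<in>I. (\<bar>a i\<bar> * (1 / sqrt (real D)))\<^sup>2) = (\<Sum>i<D. (a i)\<^sup>2) / real D"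
    unfolding sum_divide_distrib using sub assms(1)
    by (intro sum.mono_neutral_cong_left) (auto simp: I_def power_divide power_mult_distrib)
  ultimately show ?thesis by (simp add: L2_set_def real_sqrt_divide)
qed

text \<open>Completing the square: exponential tilting shifts the mean. Integrating gives the moment
  generating function.\<close>

lemma normal_density_times_exp:
  assumes "0 < \<sigma>"
  shows "normal_density 0 \<sigma> x * exp (t * x) = exp (t\<^sup>2 * \<sigma>\<^sup>2 / 2) * normal_density (t * \<sigma>\<^sup>2) \<sigma> x"
proof -
  have "- (x - 0)\<^sup>2 / (2 * \<sigma>\<^sup>2) + t * x = t\<^sup>2 * \<sigma>\<^sup>2 / 2 - (x - t * \<sigma>\<^sup>2)\<^sup>2 / (2 * \<sigma>\<^sup>2)"
    using assms by (simp add: field_simps power2_eq_square)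
  then show ?thesis unfolding normal_density_def
    by (simp add: exp_add[symmetric] mult.assoc mult.left_commute)
qed

section \<open>Moments of a projected difference\<close>

context
  fixes D :: nat assumes D: "1 \<le> D"
begin

lemma gaussian_sq:
  "integrable (gaussian D) (\<lambda>v. (vinner D y v - vinner D z v)\<^sup>2)" (is ?I)
  "(\<integral>v. (vinner D y v - vinner D z v)\<^sup>2 \<partial>gaussian D) = (vdist D y z)\<^sup>2 / real D" (is ?E)
proof -
  let ?a = "\<lambda>i. y i - z i"
  let ?s = "vdist D y z / sqrt (real D)"
  have "?I \<and> ?E"
  \<comment> \<open>At distance \<open>0\<close> the projection is constant and has no normal
    density, so this case is separate here and in the next two lemmas.\<close>
  proof (cases "vdist D y z = 0")
    case True
    then show ?thesis by (simp add: vinner_diff vdist_def L2_set_eq_0_iff vinner_def)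
  next
    case False
    then have pos: "0 < ?s" using D vdist_nonneg[of D y z] by (simp add: less_le)
    have dist: "distributed (gaussian D) lborel (\<lambda>v. vinner D ?a v) (normal_density 0 ?s)"
      using gaussian_vinner_distributed[OF D, of ?a] False vdist_nonneg[of D y z]
      by (simp add: vdist_def less_le)
    show ?thesis
      using distributed_integral[OF dist, of "\<lambda>x. x\<^sup>2"] distributed_integrable[OF dist, of "\<lambda>x. x\<^sup>2"]
        integrable_normal_moment[OF pos, of 0 2] integral_normal_moment_even[OF pos, of 0 1] D
      by (simp add: vinner_diff power_divide)
  qed
  then show ?I ?E by auto
qed

lemma gaussian_abs:
  "integrable (gaussian D) (\<lambda>v. \<bar>vinner D y v - vinner D z v\<bar>)" (is ?I)
  "(\<integral>v. \<bar>vinner D y v - vinner D z v\<bar> \<partial>gaussian D) = sqrt (2 / pi) * (vdist D y z / sqrt (real D))" (is ?E)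
proof -
  let ?a = "\<lambda>i. y i - z i"
  let ?s = "vdist D y z / sqrt (real D)"
  have "?I \<and> ?E"
  proof (cases "vdist D y z = 0")
    case True
    then show ?thesis by (simp add: vinner_diff vdist_def L2_set_eq_0_iff vinner_def)
  next
    case False
    then have pos: "0 < ?s" using D vdist_nonneg[of D y z] by (simp add: less_le)
    have dist: "distributed (gaussian D) lborel (\<lambda>v. vinner D ?a v) (normal_density 0 ?s)"
      using gaussian_vinner_distributed[OF D, of ?a] False vdist_nonneg[of D y z]
      by (simp add: vdist_def less_le)
    show ?thesis
      using distributed_integral[OF dist, of abs] distributed_integrable[OF dist, of abs]
        integrable_normal_moment_abs[OF pos, of 0 1] integral_normal_moment_abs_odd[OF pos, of 0 0] D
      by (simp add: vinner_diff)
  qed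
  then show ?I ?E by auto
qed

text \<open>Bound the exponential of the absolute value by the sum over both signs. Each has
  expectation at most \<open>exp (1/2) \<le> 2\<close>, because the standard deviation is at most
  \<open>\<tau>\<close>; this gives \<open>4\<close>.\<close>

lemma gaussian_exp:
  assumes "vdist D y z / sqrt (real D) \<le> \<tau>" "0 < \<tau>"
  shows "integrable (gaussian D) (\<lambda>v. exp (\<bar>vinner D y v - vinner D z v\<bar> / \<tau>))" (is ?I)
    and "(\<integral>v. exp (\<bar>vinner D y v - vinner D z v\<bar> / \<tau>) \<partial>gaussian D) \<le> 4" (is ?E)
proof -
  interpret prob_space "gaussian D" using D by (rule prob_space_gaussian)
  let ?a = "\<lambda>i. y i - z i"
  let ?s = "vdist D y z / sqrt (real D)"
  let ?X = "\<lambda>v. vinner D ?a v"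
  have "?I \<and> ?E"
  proof (cases "vdist D y z = 0")
    case True
    then have "?X v = 0" for v by (simp add: vdist_def L2_set_eq_0_iff vinner_def)
    then show ?thesis by (simp add: vinner_diff prob_space)
  next
    case False
    then have pos: "0 < ?s" using D vdist_nonneg[of D y z] by (simp add: less_le)
    have dist: "distributed (gaussian D) lborel ?X (normal_density 0 ?s)"
      using gaussian_vinner_distributed[OF D, of ?a] False vdist_nonneg[of D y z]
      by (simp add: vdist_def less_le)
    have e: "integrable (gaussian D) (\<lambda>v. exp (t * ?X v)) \<and>
        (\<integral>v. exp (t * ?X v) \<partial>gaussian D) = exp (t\<^sup>2 * ?s\<^sup>2 / 2)" for t
      using distributed_integral[OF dist, of "\<lambda>x. exp (t * x)"] distributed_integrable[OF dist, of "\<lambda>x. exp (t * x)"]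
        integrable_normal_density[OF pos] integral_normal_density[OF pos] normal_density_times_exp[OF pos]
      by simp
    have "(1/\<tau>)\<^sup>2 * ?s\<^sup>2 = (?s / \<tau>)\<^sup>2" by (simp add: power_divide power_mult_distrib)
    also have "\<dots> \<le> 1"
    proof (rule power_le_one)
      show "0 \<le> ?s / \<tau>" using pos assms(2) by (intro divide_nonneg_pos less_imp_le)
      show "?s / \<tau> \<le> 1" using assms by (subst divide_le_eq_1_pos)
    qed
    finally have "exp ((1/\<tau>)\<^sup>2 * ?s\<^sup>2 / 2) \<le> exp (1/2)" by simp
    moreover have "exp (1/2::real) \<le> 2"
      using exp_bound_half[of "1/2::real"] by simp
    ultimately have le: "exp ((1/\<tau>)\<^sup>2 * ?s\<^sup>2 / 2) \<le> 2" by linarith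
    have *: "exp (\<bar>?X v\<bar> / \<tau>) \<le> exp (1/\<tau> * ?X v) + exp (-(1/\<tau>) * ?X v)" for v
      by (cases "0 \<le> ?X v") (auto simp: abs_if)
    have int: "integrable (gaussian D) (\<lambda>v. exp (1/\<tau> * ?X v) + exp (-(1/\<tau>) * ?X v))"
      using e[of "1/\<tau>"] e[of "-(1/\<tau>)"] by auto
    have I: "integrable (gaussian D) (\<lambda>v. exp (\<bar>?X v\<bar> / \<tau>))"
      by (rule Bochner_Integration.integrable_bound[OF int])
        (use * in \<open>auto intro!: AE_I2 simp: add_pos_pos less_imp_le\<close>)
    have "(\<integral>v. exp (\<bar>?X v\<bar> / \<tau>) \<partial>gaussian D) \<le> (\<integral>v. exp (1/\<tau> * ?X v) + exp (-(1/\<tau>) * ?X v) \<partial>gaussian D)"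
      by (rule integral_mono[OF I int *])
    also have "\<dots> = 2 * exp ((1/\<tau>)\<^sup>2 * ?s\<^sup>2 / 2)"
      using e[of "1/\<tau>"] e[of "-(1/\<tau>)"] by (subst Bochner_Integration.integral_add) auto
    finally show ?thesis using I le by (simp add: vinner_diff)
  qed
  then show ?I ?E by auto
qed

end

section \<open>Chaining\<close>

text \<open>The right-hand side comes from the tangent of \<open>exp t / N\<close> at
  \<open>t = ln N\<close>, with a surplus of \<open>1\<close> given away.\<close>

lemma le_exp_div_plus_ln:
  fixes t N :: real
  assumes "0 < N"
  shows "t \<le> exp t / N + ln N"
  using exp_ge_add_one_self[of "t - ln N"] assms by (simp add: exp_diff)

text \<open>The total weight of a chain: it stays below \<open>14\<close> whatever the number
  \<open>m\<close> of levels.\<close>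

lemma sum_arith_geometric: "(\<Sum>k<m. (2 * real k + 5) / 2 ^ k) = 14 - (4 * real m + 14) / 2 ^ m"
proof (induction m)
  case (Suc m)
  have "14 - (4 * real m + 14) / 2 ^ m + (2 * real m + 5) / 2 ^ m = 14 - (4 * real (Suc m) + 14) / 2 ^ Suc m"
    by (simp add: field_simps)
  then show ?case by (simp only: sum.lessThan_Suc Suc)
qed simp

lemma nets_exist:
  assumes "doubling D C d" "z \<in> vecs D" "0 < r" "K \<subseteq> vball D z r \<inter> C"
  obtains A :: "nat \<Rightarrow> vec set" and \<pi> where
    "A 0 = {z}" "\<And>k. finite (A k)" "\<And>k. card (A k) \<le> 2 ^ (d * k)"
    "\<And>k y. y \<in> K \<Longrightarrow> \<pi> k y \<in> A k" "\<And>k y. y \<in> K \<Longrightarrow> vdist D (\<pi> k y) y \<le> r / 2 ^ k"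
proof -
  let ?P = "\<lambda>k A. finite A \<and> card A \<le> 2 ^ (d * k) \<and> K \<subseteq> (\<Union>a\<in>A. vball D a (r / 2 ^ k))"
  have "\<exists>A. ?P k A" for k
  proof -
    obtain A where "finite A" "card A \<le> 2 ^ (d * k)" "vball D z r \<inter> C \<subseteq> (\<Union>a\<in>A. vball D a (r / 2 ^ k))"
      using doubling_cover[OF assms(1-3), of k] by (elim exE conjE)
    then show ?thesis using subset_trans[OF assms(4)] by (intro exI[of _ A] conjI)
  qed
  then obtain B where B: "\<And>k. ?P k (B k)" by metis
  \<comment> \<open>Level \<open>0\<close> is reset to \<open>{z}\<close>, so that every chain
    starts exactly at \<open>z\<close>.\<close>
  define A where "A = B(0 := {z})"
  have A: "?P k (A k)" for k
    using B[of k] assms(4) by (cases k) (auto simp: A_def)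
  define \<pi> where "\<pi> = (\<lambda>k y. SOME a. a \<in> A k \<and> y \<in> vball D a (r / 2 ^ k))"
  have \<pi>: "\<pi> k y \<in> A k \<and> y \<in> vball D (\<pi> k y) (r / 2 ^ k)" if "y \<in> K" for k y
  proof -
    have "\<exists>a. a \<in> A k \<and> y \<in> vball D a (r / 2 ^ k)" using A[of k] that by blast
    then show ?thesis unfolding \<pi>_def by (rule someI_ex)
  qed
  show ?thesis
    by (rule that[of A \<pi>]) (use A \<pi> in \<open>auto simp: A_def mem_vball\<close>)
qed

text \<open>
  The bound \<open>d\<close> instead of \<open>sqrt d\<close> is not sharp. It only affects constants, since the number of
  covering balls enters the final bound through its logarithm, and it lets the maximum over
  \<open>N\<close> Gaussians be dominated by the integrable function coming from \<open>t \<le> exp t / N + ln N\<close>.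
\<close>

lemma chaining:
  assumes D: "1 \<le> D" and d: "1 \<le> d" and dbl: "doubling D C d" and z: "z \<in> vecs D" and r: "0 < r"
    and K: "finite K" "K \<subseteq> vball D z r \<inter> C"
  obtains F where "integrable (gaussian D) F" "\<And>v. 0 \<le> F v"
    "\<And>v y. y \<in> K \<Longrightarrow> \<bar>vinner D y v - vinner D z v\<bar> \<le> F v"
    "(\<integral>v. F v \<partial>gaussian D) \<le> 30 * r * d / sqrt D"
proof -
  interpret prob_space "gaussian D" using D by (rule prob_space_gaussian)
  obtain A \<pi> where A: "A 0 = {z}" "\<And>k. finite (A k)" "\<And>k. card (A k) \<le> 2 ^ (d * k)"
    and \<pi>: "\<And>k y. y \<in> K \<Longrightarrow> \<pi> k y \<in> A k" "\<And>k y. y \<in> K \<Longrightarrow> vdist D (\<pi> k y) y \<le> r / 2 ^ k"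
    using nets_exist[OF dbl z r K(2)] by metis
  \<comment> \<open>Chains stop at level \<open>card K\<close>: each of the \<open>m\<close> points
    then leaves a residual of size \<open>r / 2 ^ m\<close>, and even the plain sum \<open>g\<close>
    of these residuals costs only \<open>m / 2 ^ m \<le> 1\<close> times
    \<open>r / sqrt D\<close>.\<close>
  define m where "m = card K"
  define X where "X = (\<lambda>a b v. \<bar>vinner D b v - vinner D a v\<bar>)"
  \<comment> \<open>A link joins approximations at distance at most
    \<open>r / 2 ^ k + r / 2 ^ Suc k \<le> 2 * r / 2 ^ k\<close>. The number \<open>N k\<close> of
    possible links is the product of the two net sizes, with exponent
    \<open>d * k + d * (k + 1)\<close>.\<close>
  define \<sigma> where "\<sigma> = (\<lambda>k::nat. 2 * r / 2 ^ k / sqrt D)"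
  define N where "N = (\<lambda>k::nat. 2 ^ (d * (2 * k + 1)) :: real)"
  \<comment> \<open>Only pairs close enough to be consecutive in a chain are kept; their standard
    deviation is at most \<open>\<sigma> k\<close>, as \<open>gaussian_exp\<close> requires.\<close>
  define P where "P = (\<lambda>k. {(a, b) \<in> A k \<times> A (Suc k). vdist D b a / sqrt D \<le> \<sigma> k})"
  define f where "f = (\<lambda>k v. \<sigma> k * ((\<Sum>(a, b)\<in>P k. exp (X a b v / \<sigma> k)) / N k + ln (N k)))"
  define g where "g = (\<lambda>v. \<Sum>y\<in>K. X (\<pi> m y) y v)"
  define F where "F = (\<lambda>v. (\<Sum>k<m. f k v) + g v)"
  have \<sigma>: "0 < \<sigma> k" for k using r D by (simp add: \<sigma>_def)
  have N: "1 \<le> N k" for k by (simp add: N_def)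
  have N0: "0 < N k" for k by (simp add: N_def)
  have finP: "finite (P k)" for k
    unfolding P_def by (rule finite_subset[of _ "A k \<times> A (Suc k)"]) (use A(2) in auto)
  have cardP: "card (P k) \<le> N k" for k
  proof -
    have "card (P k) \<le> card (A k \<times> A (Suc k))"
      unfolding P_def using A(2) by (intro card_mono) auto
    also have "\<dots> \<le> 2 ^ (d * k) * 2 ^ (d * Suc k)"
      unfolding card_cartesian_product by (intro mult_mono A(3)) auto
    also have "\<dots> = 2 ^ (d * (2 * k + 1))" by (simp add: power_add[symmetric] algebra_simps)
    finally have "real (card (P k)) \<le> real (2 ^ (d * (2 * k + 1)))" by (simp only: of_nat_le_iff)
    then show ?thesis by (simp add: N_def)
  qed
  have f_int: "integrable (gaussian D) (f k)" for k
  proof -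
    have "integrable (gaussian D) (\<lambda>v. \<Sum>(a, b)\<in>P k. exp (X a b v / \<sigma> k))"
    proof (rule Bochner_Integration.integrable_sum)
      fix q assume "q \<in> P k"
      then show "integrable (gaussian D) (\<lambda>v. case q of (a, b) \<Rightarrow> exp (X a b v / \<sigma> k))"
        using gaussian_exp(1)[OF D _ \<sigma>[of k], of "snd q" "fst q"] by (auto simp: P_def X_def)
    qed
    then show ?thesis unfolding f_def by simp
  qed
  have X_int: "integrable (gaussian D) (X a b)" for a b
    unfolding X_def by (rule gaussian_abs(1)[OF D])
  have g_int: "integrable (gaussian D) g"
    unfolding g_def by (rule Bochner_Integration.integrable_sum) (rule X_int)
  have F_int: "integrable (gaussian D) F"
    unfolding F_def by (intro Bochner_Integration.integrable_add Bochner_Integration.integrable_sum f_int g_int)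
  have f0: "0 \<le> f k v" for k v
    unfolding f_def using \<sigma>[of k] N[of k] N0[of k]
    by (auto intro!: mult_nonneg_nonneg add_nonneg_nonneg sum_nonneg divide_nonneg_pos)
  have F0: "0 \<le> F v" for v
    unfolding F_def g_def X_def by (intro add_nonneg_nonneg sum_nonneg f0) auto
  have Xf: "X a b v \<le> f k v" if "(a, b) \<in> P k" for a b k v
  proof -
    have "X a b v / \<sigma> k \<le> exp (X a b v / \<sigma> k) / N k + ln (N k)"
      by (rule le_exp_div_plus_ln[OF N0])
    also have "\<dots> \<le> (\<Sum>(a, b)\<in>P k. exp (X a b v / \<sigma> k)) / N k + ln (N k)"
      using member_le_sum[OF that, of "\<lambda>(a, b). exp (X a b v / \<sigma> k)"] finP[of k] N0[of k]
      by (auto intro!: divide_right_mono)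
    finally show ?thesis using \<sigma>[of k] by (simp add: f_def divide_le_eq mult.commute)
  qed
  have FK: "\<bar>vinner D y v - vinner D z v\<bar> \<le> F v" if y: "y \<in> K" for y v
  proof -
    have inP: "(\<pi> k y, \<pi> (Suc k) y) \<in> P k" for k
    proof -
      have "vdist D (\<pi> (Suc k) y) (\<pi> k y) \<le> vdist D (\<pi> (Suc k) y) y + vdist D y (\<pi> k y)"
        by (rule vdist_triangle)
      also have "\<dots> \<le> r / 2 ^ Suc k + r / 2 ^ k"
        using \<pi>(2)[OF y, of "Suc k"] \<pi>(2)[OF y, of k] by (simp add: vdist_commute)
      also have "\<dots> \<le> 2 * r / 2 ^ k" using r by (simp add: field_simps)
      finally have "vdist D (\<pi> (Suc k) y) (\<pi> k y) / sqrt D \<le> \<sigma> k"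
        unfolding \<sigma>_def by (rule divide_right_mono) simp
      then show ?thesis unfolding P_def using \<pi>(1)[OF y] by simp
    qed
    have "\<pi> 0 y = z" using \<pi>(1)[OF y, of 0] A(1) by simp
    then have "vinner D y v - vinner D z v =
        (\<Sum>k<m. vinner D (\<pi> (Suc k) y) v - vinner D (\<pi> k y) v) + (vinner D y v - vinner D (\<pi> m y) v)"
      using sum_lessThan_telescope[of "\<lambda>k. vinner D (\<pi> k y) v" m] by simp
    then have "\<bar>vinner D y v - vinner D z v\<bar> \<le>
        \<bar>\<Sum>k<m. vinner D (\<pi> (Suc k) y) v - vinner D (\<pi> k y) v\<bar> + X (\<pi> m y) y v"
      by (simp only: X_def abs_triangle_ineq)
    also have "\<dots> \<le> (\<Sum>k<m. X (\<pi> k y) (\<pi> (Suc k) y) v) + X (\<pi> m y) y v"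
      unfolding X_def by (intro add_right_mono sum_abs)
    also have "\<dots> \<le> F v"
      unfolding F_def g_def using y K(1) inP
      by (intro add_mono sum_mono Xf member_le_sum) (auto simp: X_def)
    finally show ?thesis .
  qed
  have Ef: "(\<integral>v. f k v \<partial>gaussian D) \<le> 2 * r * d / sqrt D * ((2 * real k + 5) / 2 ^ k)" for k
  proof -
    have E4: "(\<integral>v. exp (X (fst q) (snd q) v / \<sigma> k) \<partial>gaussian D) \<le> 4" if "q \<in> P k" for q
      using gaussian_exp(2)[OF D _ \<sigma>[of k], of "snd q" "fst q"] that by (auto simp: P_def X_def)
    have I: "integrable (gaussian D) (\<lambda>v. exp (X (fst q) (snd q) v / \<sigma> k))" if "q \<in> P k" for q
      using gaussian_exp(1)[OF D _ \<sigma>[of k], of "snd q" "fst q"] that by (auto simp: P_def X_def)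
    have "(\<integral>v. f k v \<partial>gaussian D) =
        \<sigma> k * ((\<Sum>q\<in>P k. \<integral>v. exp (X (fst q) (snd q) v / \<sigma> k) \<partial>gaussian D) / N k + ln (N k))"
      using I by (simp add: f_def case_prod_beta prob_space Bochner_Integration.integrable_sum)
    also have "\<dots> \<le> \<sigma> k * (4 + real d * (2 * real k + 1))"
    proof (intro mult_left_mono add_mono)
      have "(\<Sum>q\<in>P k. \<integral>v. exp (X (fst q) (snd q) v / \<sigma> k) \<partial>gaussian D) \<le> card (P k) * 4"
        using sum_bounded_above[of "P k" "\<lambda>q. \<integral>v. exp (X (fst q) (snd q) v / \<sigma> k) \<partial>gaussian D" 4] E4 by simp
      also have "\<dots> \<le> N k * 4" using cardP[of k] by simp
      finally show "(\<Sum>q\<in>P k. \<integral>v. exp (X (fst q) (snd q) v / \<sigma> k) \<partial>gaussian D) / N k \<le> 4"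
        using N0[of k] by (simp add: divide_le_eq mult.commute)
      have "ln (N k) = real d * (2 * real k + 1) * ln 2" by (simp add: N_def ln_realpow algebra_simps)
      also have "\<dots> \<le> real d * (2 * real k + 1) * 1" using ln_2_less_1 by (intro mult_left_mono) auto
      finally show "ln (N k) \<le> real d * (2 * real k + 1)" by simp
    qed (use \<sigma>[of k] in simp)
    also have "\<dots> \<le> \<sigma> k * (d * (2 * real k + 5))"
      using \<sigma>[of k] d by (intro mult_left_mono) (auto simp: algebra_simps)
    also have "\<dots> = 2 * r * d / sqrt D * ((2 * real k + 5) / 2 ^ k)" by (simp add: \<sigma>_def mult_ac)
    finally show ?thesis .
  qed
  have Eg: "(\<integral>v. g v \<partial>gaussian D) \<le> r / sqrt D"
  proof -
    have "(\<integral>v. g v \<partial>gaussian D) = (\<Sum>y\<in>K. \<integral>v. X (\<pi> m y) y v \<partial>gaussian D)"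
      unfolding g_def using X_int by (intro Bochner_Integration.integral_sum)
    also have "\<dots> \<le> (\<Sum>y\<in>K. r / 2 ^ m / sqrt D)"
    proof (rule sum_mono)
      fix y assume y: "y \<in> K"
      have "sqrt (2 / pi) \<le> 1" using pi_ge_two by simp
      then have "(\<integral>v. X (\<pi> m y) y v \<partial>gaussian D) \<le> 1 * (vdist D y (\<pi> m y) / sqrt D)"
        unfolding X_def gaussian_abs(2)[OF D] by (intro mult_right_mono) auto
      also have "\<dots> \<le> r / 2 ^ m / sqrt D"
        unfolding mult_1 using \<pi>(2)[OF y, of m]
        by (intro divide_right_mono) (simp_all only: vdist_commute[of D y] real_sqrt_ge_0_iff of_nat_0_le_iff)
      finally show "(\<integral>v. X (\<pi> m y) y v \<partial>gaussian D) \<le> r / 2 ^ m / sqrt D" .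
    qed
    also have "\<dots> = real m / 2 ^ m * (r / sqrt D)" by (simp add: m_def)
    also have "\<dots> \<le> 1 * (r / sqrt D)"
      using of_nat_less_two_power[of m, where 'a = real] r by (intro mult_right_mono) auto
    finally show ?thesis by simp
  qed
  have "(\<integral>v. F v \<partial>gaussian D) = (\<Sum>k<m. \<integral>v. f k v \<partial>gaussian D) + (\<integral>v. g v \<partial>gaussian D)"
    unfolding F_def using f_int g_int by (simp add: Bochner_Integration.integrable_sum)
  also have "\<dots> \<le> (\<Sum>k<m. 2 * r * d / sqrt D * ((2 * real k + 5) / 2 ^ k)) + r / sqrt D"
    by (intro add_mono sum_mono Ef Eg)
  also have "\<dots> = 2 * r * d / sqrt D * (14 - (4 * real m + 14) / 2 ^ m) + r / sqrt D"
    by (simp only: sum_distrib_left[symmetric] sum_arith_geometric)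
  also have "\<dots> \<le> 2 * r * d / sqrt D * 14 + r * d / sqrt D"
    using r d D by (intro add_mono mult_left_mono divide_right_mono) auto
  also have "\<dots> = 29 * (r * d / sqrt D)" by simp
  also have "\<dots> \<le> 30 * (r * d / sqrt D)" using r by (intro mult_right_mono) auto
  finally show ?thesis using that[of F] F_int F0 FK by simp
qed

section \<open>Medians and measurability of a split\<close>

lemma length_filter_sorted_image:
  assumes "finite T"
  shows "length (filter P (sorted_list_of_multiset (image_mset f (mset_set T)))) = card {z \<in> T. P (f z)}"
proof -
  have "length (filter P (sorted_list_of_multiset (image_mset f (mset_set T))))
      = size (filter_mset P (image_mset f (mset_set T)))"
    by (metis mset_filter mset_sorted_list_of_multiset size_mset)
  also have "\<dots> = card {z \<in> T. P (f z)}"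
    using assms by (simp add: filter_mset_image_mset filter_mset_mset_set)
  finally show ?thesis .
qed

text \<open>If a middle entry of the sorted list were off by more than \<open>h\<close>, then so
  would be all entries on its outer side, which are at least half of the list. Both middle entries
  are therefore near \<open>c\<close>, and so is their mean.\<close>

lemma median_near:
  fixes f :: "'a \<Rightarrow> real"
  assumes T: "finite T" "T \<noteq> {}" and far: "2 * card {z \<in> T. h < \<bar>f z - c\<bar>} < card T"
  shows "\<bar>median (image_mset f (mset_set T)) - c\<bar> \<le> h"
proof -
  define xs where "xs = sorted_list_of_multiset (image_mset f (mset_set T))"
  define n where "n = card T"
  have len: "length xs = n"
    using T(1) by (simp add: xs_def n_def size_mset[symmetric] del: size_mset)
  have n: "0 < n" using T by (simp add: n_def card_gt_0_iff)
  have sorted: "sorted xs" by (simp add: xs_def)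
  have cnt: "card {i. i < n \<and> h < \<bar>xs ! i - c\<bar>} = card {z \<in> T. h < \<bar>f z - c\<bar>}"
    using length_filter_sorted_image[OF T(1), of "\<lambda>t. h < \<bar>t - c\<bar>" f]
    by (simp add: xs_def[symmetric] length_filter_conv_card len)
  have near: "\<bar>xs ! j - c\<bar> \<le> h" if j: "(n - 1) div 2 \<le> j" "j \<le> n div 2" "j < n" for j
  proof (rule ccontr)
    assume "\<not> \<bar>xs ! j - c\<bar> \<le> h"
    then consider "c + h < xs ! j" | "xs ! j < c - h" by linarith
    then show False
    proof cases
      case 1
      have "{j..<n} \<subseteq> {i. i < n \<and> h < \<bar>xs ! i - c\<bar>}"
      proof safe
        fix i assume "i \<in> {j..<n}"
        then have "xs ! j \<le> xs ! i" using sorted len by (simp add: sorted_nth_mono)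
        then show "h < \<bar>xs ! i - c\<bar>" using 1 by linarith
      qed simp
      then have "card {j..<n} \<le> card {i. i < n \<and> h < \<bar>xs ! i - c\<bar>}" by (intro card_mono) auto
      then show False using cnt far j by (simp add: n_def)
    next
      case 2
      have "{..j} \<subseteq> {i. i < n \<and> h < \<bar>xs ! i - c\<bar>}"
      proof safe
        fix i assume "i \<le> j"
        then have "xs ! i \<le> xs ! j" using sorted len j by (simp add: sorted_nth_mono)
        then show "h < \<bar>xs ! i - c\<bar>" using 2 by linarith
      qed (use j in simp)
      then have "card {..j} \<le> card {i. i < n \<and> h < \<bar>xs ! i - c\<bar>}" by (intro card_mono) auto
      then show False using cnt far j n by (simp add: n_def)
    qed
  qed
  have "median (image_mset f (mset_set T)) = (xs ! ((n - 1) div 2) + xs ! (n div 2)) / 2"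
    using T(1) by (simp add: median_def xs_def n_def Let_def)
  moreover have "\<bar>xs ! ((n - 1) div 2) - c\<bar> \<le> h" "\<bar>xs ! (n div 2) - c\<bar> \<le> h"
    using n by (auto intro!: near)
  moreover have "\<bar>(a + b) / 2 - c\<bar> \<le> h" if "\<bar>a - c\<bar> \<le> h" "\<bar>b - c\<bar> \<le> h" for a b
    using that unfolding abs_le_iff by (auto simp: field_simps)
  ultimately show ?thesis by simp
qed

text \<open>Expresses an order statistic by counting, so that its sublevel sets become events about
  finite sums of indicators. Indices start at \<open>0\<close>, hence the strict inequality on the
  right.\<close>

lemma sorted_nth_le_iff:
  fixes c :: "'a::linorder"
  assumes "sorted xs" "j < length xs"
  shows "xs ! j \<le> c \<longleftrightarrow> j < length (filter (\<lambda>t. t \<le> c) xs)"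
proof
  assume *: "xs ! j \<le> c"
  have "{..j} \<subseteq> {i. i < length xs \<and> xs ! i \<le> c}"
    using assms * by (auto intro: order_trans[OF sorted_nth_mono])
  then have "card {..j} \<le> card {i. i < length xs \<and> xs ! i \<le> c}" by (intro card_mono) auto
  then show "j < length (filter (\<lambda>t. t \<le> c) xs)" by (simp add: length_filter_conv_card)
next
  assume *: "j < length (filter (\<lambda>t. t \<le> c) xs)"
  show "xs ! j \<le> c"
  proof (rule ccontr)
    assume nle: "\<not> xs ! j \<le> c"
    have "{i. i < length xs \<and> xs ! i \<le> c} \<subseteq> {..<j}"
    proof safe
      fix i assume i: "i < length xs" "xs ! i \<le> c"
      show "i < j"
      proof (rule ccontr)
        assume "\<not> i < j"
        then have "xs ! j \<le> xs ! i" using assms i by (simp add: sorted_nth_mono)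
        then show False using i(2) nle by simp
      qed
    qed
    then have "card {i. i < length xs \<and> xs ! i \<le> c} \<le> card {..<j}" by (intro card_mono) auto
    then show False using * by (simp add: length_filter_conv_card)
  qed
qed

text \<open>The sorting permutation varies with \<open>v\<close>, so measurability is shown for each
  order statistic through the counting criterion, not through the permutation.\<close>

lemma median_measurable:
  assumes T: "finite T" and f: "\<And>z. z \<in> T \<Longrightarrow> f z \<in> borel_measurable M"
  shows "(\<lambda>v. median (image_mset (\<lambda>z. f z v) (mset_set T))) \<in> borel_measurable M"
proof (cases "T = {}")
  case True
  then show ?thesis by simp
next
  case False
  define xs where "xs = (\<lambda>v. sorted_list_of_multiset (image_mset (\<lambda>z. f z v) (mset_set T)))"
  have len: "length (xs v) = card T" for v
    using T by (simp add: xs_def size_mset[symmetric] del: size_mset)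
  have m: "(\<lambda>v. xs v ! j) \<in> borel_measurable M" if j: "j < card T" for j
  proof (rule borel_measurableI_le)
    fix c
    have "xs v ! j \<le> c \<longleftrightarrow> real j < (\<Sum>z\<in>T. if f z v \<le> c then 1 else 0)" for v
    proof -
      have "xs v ! j \<le> c \<longleftrightarrow> j < card {z \<in> T. f z v \<le> c}"
        using sorted_nth_le_iff[of "xs v" j c] length_filter_sorted_image[OF T, of "\<lambda>t. t \<le> c" "\<lambda>z. f z v"] len[of v] j
        by (simp add: xs_def)
      also have "real (card {z \<in> T. f z v \<le> c}) = (\<Sum>z\<in>T. if f z v \<le> c then 1 else 0)"
        using T by (simp add: sum.If_cases Int_def)
      then have "j < card {z \<in> T. f z v \<le> c} \<longleftrightarrow> real j < (\<Sum>z\<in>T. if f z v \<le> c then 1 else 0)"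
        by (metis of_nat_less_iff)
      finally show ?thesis .
    qed
    moreover have "(\<lambda>v. \<Sum>z\<in>T. if f z v \<le> c then 1 else 0 :: real) \<in> borel_measurable M"
      using f by (intro borel_measurable_sum measurable_If) auto
    ultimately show "{v \<in> space M. xs v ! j \<le> c} \<in> sets M" by simp
  qed
  have "card T \<noteq> 0" using T False by simp
  then have "(card T - 1) div 2 < card T" "card T div 2 < card T" by auto
  then have "(\<lambda>v. (xs v ! ((card T - 1) div 2) + xs v ! (card T div 2)) / 2) \<in> borel_measurable M"
    using m by (intro borel_measurable_divide borel_measurable_add) auto
  then show ?thesis using T by (simp add: median_def xs_def Let_def)
qed

lemma split_cell_subset: "split_cell D T x n b \<subseteq> T"
  by (cases n) (auto simp: split_cell_def Let_def)

lemma fst_split_noise [measurable]: "fst \<in> measurable (split_noise D) (gaussian D)"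
  and snd_split_noise [measurable]: "snd \<in> borel_measurable (split_noise D)"
  by (auto simp: split_noise_def measurable_cong_sets[OF refl sets_uniform_measure])

text \<open>An arbitrary \<open>Q\<close> is allowed because a child is one of finitely many subsets
  of \<open>T\<close>; the event is a finite union of events that fix the child, each given by
  finitely many threshold comparisons.\<close>

lemma split_cell_measurable:
  assumes "finite T"
  shows "{n \<in> space (split_noise D). Q (split_cell D T x n b)} \<in> sets (split_noise D)"
proof -
  define t where "t = (\<lambda>n :: noise. median (image_mset (\<lambda>z. vinner D z (fst n)) (mset_set T)) +
      snd n * (6 * Max ((\<lambda>y. vdist D x y) ` T) / sqrt (real D)))"
  have vin [measurable]: "(\<lambda>n. vinner D z (fst n)) \<in> borel_measurable (split_noise D)" for z
    by (rule measurable_compose[OF fst_split_noise vinner_measurable])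
  have [measurable]: "t \<in> borel_measurable (split_noise D)"
    unfolding t_def using assms
    by (intro borel_measurable_add borel_measurable_times median_measurable vin snd_split_noise) auto
  have eq: "split_cell D T x n b = {y \<in> T. vinner D y (fst n) < t n \<longleftrightarrow> b}" for n
    by (cases n) (simp add: split_cell_def t_def Let_def)
  have 1: "{n \<in> space (split_noise D). vinner D y (fst n) < t n \<longleftrightarrow> b} \<in> sets (split_noise D)" for y
    by measurable
  have "{n \<in> space (split_noise D). split_cell D T x n b = T'} =
      {n \<in> space (split_noise D). T' \<subseteq> T \<and> (\<forall>y\<in>T. (vinner D y (fst n) < t n \<longleftrightarrow> b) \<longleftrightarrow> y \<in> T')}" for T'
    unfolding eq by blast
  moreover have "{n \<in> space (split_noise D). T' \<subseteq> T \<and> (\<forall>y\<in>T. (vinner D y (fst n) < t n \<longleftrightarrow> b) \<longleftrightarrow> y \<in> T')}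
      \<in> sets (split_noise D)" for T'
    using assms 1 by (intro sets.sets_Collect_conj sets.sets_Collect_const sets.sets_Collect_finite_All
      sets.sets_Collect_imp) (auto simp: sets.sets_Collect_const)
  ultimately have "{n \<in> space (split_noise D). split_cell D T x n b = T'} \<in> sets (split_noise D)" for T'
    by simp
  then have "(\<Union>T'\<in>{T' \<in> Pow T. Q T'}. {n \<in> space (split_noise D). split_cell D T x n b = T'}) \<in> sets (split_noise D)"
    using assms by (intro sets.finite_UN) auto
  also have "(\<Union>T'\<in>{T' \<in> Pow T. Q T'}. {n \<in> space (split_noise D). split_cell D T x n b = T'}) =
      {n \<in> space (split_noise D). Q (split_cell D T x n b)}"
    using split_cell_subset[of D T x _ b] by auto
  finally show ?thesis .
qed

section \<open>The effect of one split on two distant balls\<close>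

abbreviation unif :: "real measure" where
  "unif \<equiv> uniform_measure lborel {-1..1}"

lemma prob_space_unif: "prob_space unif"
  by (rule prob_space_uniform_measure) auto

definition unif_cdf :: "real \<Rightarrow> real" where
  "unif_cdf c = max 0 (min 1 ((c + 1) / 2))"

lemma measure_unif_atMost: "measure unif {..c} = unif_cdf c"
proof -
  have "measure unif {..c} = measure lborel ({-1..1} \<inter> {..c}) / measure lborel {-1..1::real}"
    by (rule measure_uniform_measure) auto
  also have "{-1..1} \<inter> {..c} = {-1..min 1 c}" by auto
  finally show ?thesis by (auto simp: unif_cdf_def max_def min_def)
qed

lemma measure_unif_greaterThan: "measure unif {c<..} = 1 - unif_cdf c"
proof -
  interpret prob_space unif by (rule prob_space_unif)
  have "{c<..} = space unif - {..c}" by auto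
  then show ?thesis using prob_compl[of "{..c}"] by (simp add: measure_unif_atMost)
qed

lemma unif_cdf_mono: "a \<le> b \<Longrightarrow> unif_cdf a \<le> unif_cdf b"
  unfolding unif_cdf_def by (intro max.mono min.mono divide_right_mono) auto

lemma unif_cdf_add_le: "0 \<le> h \<Longrightarrow> unif_cdf (a + h) \<le> unif_cdf a + h / 2"
  by (auto simp: unif_cdf_def max_def min_def field_simps)

lemma unif_cdf_window: "\<bar>a\<bar> \<le> 1 \<Longrightarrow> unif_cdf a = (a + 1) / 2"
  by (auto simp: unif_cdf_def max_def min_def)

text \<open>\<open>unif_cdf\<close> is Lipschitz with constant \<open>1/2\<close>, so moving from
  \<open>\<beta>\<close> to \<open>p\<close> and from \<open>\<alpha>\<close> to \<open>p'\<close>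
  costs \<open>G / (2 * w)\<close> and \<open>G' / (2 * w)\<close>. If the window contains
  \<open>p\<close> and \<open>p'\<close>, slope \<open>1/2\<close> yields the full gap as a gain;
  otherwise monotonicity still excludes a loss.\<close>

lemma unif_cdf_gap_aux:
  assumes w: "0 < w" and G: "0 \<le> G" "0 \<le> G'" and pp: "p \<le> p'"
    and \<alpha>: "p' - G' \<le> \<alpha>" and \<beta>: "\<beta> \<le> p + G"
  shows "unif_cdf ((\<beta> - m) / w) - unif_cdf ((\<alpha> - m) / w) \<le>
    (G + G' - (if \<bar>p - m\<bar> \<le> w \<and> \<bar>p' - m\<bar> \<le> w then \<bar>p - p'\<bar> else 0)) / (2 * w)"
proof -
  have "(\<beta> - m) / w \<le> (p - m) / w + G / w"
    using \<beta> w by (simp add: add_divide_distrib[symmetric] divide_right_mono)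
  then have b: "unif_cdf ((\<beta> - m) / w) \<le> unif_cdf ((p - m) / w) + G / w / 2"
    using unif_cdf_mono unif_cdf_add_le[of "G / w" "(p - m) / w"] G w by (meson divide_nonneg_pos order_trans)
  have "(p' - m) / w \<le> (\<alpha> - m) / w + G' / w"
    using \<alpha> w by (simp add: add_divide_distrib[symmetric] divide_right_mono)
  then have a: "unif_cdf ((p' - m) / w) \<le> unif_cdf ((\<alpha> - m) / w) + G' / w / 2"
    using unif_cdf_mono unif_cdf_add_le[of "G' / w" "(\<alpha> - m) / w"] G w by (meson divide_nonneg_pos order_trans)
  have c: "unif_cdf ((p - m) / w) - unif_cdf ((p' - m) / w) \<le>
      - (if \<bar>p - m\<bar> \<le> w \<and> \<bar>p' - m\<bar> \<le> w then \<bar>p - p'\<bar> else 0) / (2 * w)"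
  proof (cases "\<bar>p - m\<bar> \<le> w \<and> \<bar>p' - m\<bar> \<le> w")
    case True
    then have "\<bar>(p - m) / w\<bar> \<le> 1" "\<bar>(p' - m) / w\<bar> \<le> 1" using w by (auto simp: abs_divide divide_le_eq_1)
    then have "unif_cdf ((p - m) / w) - unif_cdf ((p' - m) / w) = ((p - m) / w + 1) / 2 - ((p' - m) / w + 1) / 2"
      by (simp add: unif_cdf_window)
    also have "\<dots> = - \<bar>p - p'\<bar> / (2 * w)" using pp w by (simp add: field_simps)
    finally show ?thesis using True by simp
  next
    case False
    have "unif_cdf ((p - m) / w) \<le> unif_cdf ((p' - m) / w)"
      using pp w by (intro unif_cdf_mono divide_right_mono) auto
    then show ?thesis unfolding if_not_P[OF False] by simp
  qed
  have "unif_cdf ((\<beta> - m) / w) - unif_cdf ((\<alpha> - m) / w) \<le> G / w / 2 + G' / w / 2 +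
      - (if \<bar>p - m\<bar> \<le> w \<and> \<bar>p' - m\<bar> \<le> w then \<bar>p - p'\<bar> else 0) / (2 * w)"
    using a b c by linarith
  also have "\<dots> = (G + G' - (if \<bar>p - m\<bar> \<le> w \<and> \<bar>p' - m\<bar> \<le> w then \<bar>p - p'\<bar> else 0)) / (2 * w)"
    by (simp add: add_divide_distrib diff_divide_distrib mult.commute)
  finally show ?thesis .
qed

text \<open>The order of the two clusters changes with the direction, so \<open>\<alpha>\<close> and
  \<open>\<beta>\<close> are constrained against both and the crossing pair is selected by
  cases.\<close>

lemma unif_cdf_gap:
  assumes w: "0 < w" and G: "0 \<le> G" "0 \<le> G'"
    and \<alpha>: "p - G \<le> \<alpha>" "p' - G' \<le> \<alpha>" and \<beta>: "\<beta> \<le> p + G" "\<beta> \<le> p' + G'"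
  shows "unif_cdf ((\<beta> - m) / w) - unif_cdf ((\<alpha> - m) / w) \<le>
    (G + G' - (if \<bar>p - m\<bar> \<le> w \<and> \<bar>p' - m\<bar> \<le> w then \<bar>p - p'\<bar> else 0)) / (2 * w)"
proof (cases "p \<le> p'")
  case True
  then show ?thesis using unif_cdf_gap_aux[OF w G _ \<alpha>(2) \<beta>(1)] by blast
next
  case False
  have eq: "(if \<bar>p' - m\<bar> \<le> w \<and> \<bar>p - m\<bar> \<le> w then \<bar>p' - p\<bar> else 0) =
      (if \<bar>p - m\<bar> \<le> w \<and> \<bar>p' - m\<bar> \<le> w then \<bar>p - p'\<bar> else 0)" by auto
  show ?thesis
    using unif_cdf_gap_aux[OF w G(2,1) _ \<alpha>(1) \<beta>(2), of m] False unfolding eq by (simp add: add.commute)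
qed

definition touches :: "nat \<Rightarrow> vec \<Rightarrow> vec \<Rightarrow> real \<Rightarrow> vec set \<Rightarrow> bool" where
  "touches D a b r T \<longleftrightarrow> T \<inter> vball D a r \<noteq> {} \<and> T \<inter> vball D b r \<noteq> {}"

lemma touches_subset: "touches D a b r T' \<Longrightarrow> T' \<subseteq> T \<Longrightarrow> touches D a b r T"
  unfolding touches_def by blast

text \<open>
  Here \<open>A\<close> is the event that the window contains both projections and \<open>P\<close> a Chebyshev majorant of
  the indicator of its complement. The left-hand side is integrable without any measurability of
  \<open>A\<close>.
\<close>

lemma window_loss:
  fixes X \<sigma> P :: real
  assumes "0 < \<sigma>" "0 \<le> P" "\<not> A \<longrightarrow> 1 \<le> P"
  shows "\<bar>X\<bar> - X\<^sup>2 / (3 * \<sigma>) - 3 * \<sigma> / 4 * P \<le> (if A then \<bar>X\<bar> else 0)"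
proof (cases A)
  case True
  have "0 \<le> X\<^sup>2 / (3 * \<sigma>)" "0 \<le> 3 * \<sigma> / 4 * P" using assms by auto
  then have "\<bar>X\<bar> - X\<^sup>2 / (3 * \<sigma>) - 3 * \<sigma> / 4 * P \<le> \<bar>X\<bar>" by linarith
  then show ?thesis using True by simp
next
  case False
  have "0 \<le> (2 * \<bar>X\<bar> - 3 * \<sigma>)\<^sup>2 / (12 * \<sigma>)" using assms(1) by simp
  also have "\<dots> = X\<^sup>2 / (3 * \<sigma>) + 3 * \<sigma> / 4 * 1 - \<bar>X\<bar>"
    using assms(1) by (simp add: power2_eq_square field_simps)
  finally have "\<bar>X\<bar> \<le> X\<^sup>2 / (3 * \<sigma>) + 3 * \<sigma> / 4 * 1" by simp
  also have "3 * \<sigma> / 4 * 1 \<le> 3 * \<sigma> / 4 * P" using assms False by (intro mult_left_mono) auto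
  finally show ?thesis using False by simp
qed

text \<open>Fubini: for a fixed direction the split is a one-dimensional threshold event, whose
  probability is then averaged over \<open>v\<close>.\<close>

lemma measure_split_noise:
  assumes D: "1 \<le> D" and E: "E \<in> sets (split_noise D)"
  shows "integrable (gaussian D) (\<lambda>v. measure unif (Pair v -` E))"
    and "measure (split_noise D) E = (\<integral>v. measure unif (Pair v -` E) \<partial>gaussian D)"
proof -
  interpret g: prob_space "gaussian D" using D by (rule prob_space_gaussian)
  interpret u: prob_space unif by (rule prob_space_unif)
  interpret gu: pair_prob_space "gaussian D" unif ..
  have E': "E \<in> sets (gaussian D \<Otimes>\<^sub>M unif)" using E by (simp only: split_noise_def)
  have int: "integrable (gaussian D \<Otimes>\<^sub>M unif) (indicator E :: _ \<Rightarrow> real)"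
    using E' by (simp add: integrable_indicator_iff less_top[symmetric])
  have eq: "(\<integral>u. indicator E (v, u) \<partial>unif) = measure unif (Pair v -` E)" for v
  proof -
    have "(\<integral>u. indicator E (v, u) \<partial>unif) = (\<integral>u. indicator (Pair v -` E) u \<partial>unif)"
      by (simp add: indicator_def)
    also have "\<dots> = measure unif (Pair v -` E)"
      using sets_Pair1[OF E', of v] by (simp add: space_uniform_measure)
    finally show ?thesis .
  qed
  show "integrable (gaussian D) (\<lambda>v. measure unif (Pair v -` E))"
    using gu.integrable_fst'[OF int] by (simp add: eq)
  show "measure (split_noise D) E = (\<integral>v. measure unif (Pair v -` E) \<partial>gaussian D)"
    using gu.integral_fst'[OF int] sets.sets_into_space[OF E'] E' by (simp add: eq split_noise_def Int_absorb2)
qed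


text \<open>The budget in units of \<open>\<sigma>\<close>: the mean projected distance is at least
  \<open>7/10\<close>, and the majorant for the window gives away \<open>1/3\<close> for the square
  and \<open>3/4 * 4/9 = 1/3\<close> for \<open>P\<close>, which leaves \<open>1/30\<close>. The
  distance hypothesis keeps the cluster widths below \<open>1/60\<close>. The net gain
  \<open>\<sigma> / 60\<close>, divided by \<open>2 * w = 12 * \<Delta> / sqrt D\<close>, is the
  fraction with \<open>720\<close>.\<close>

lemma split_touch:
  assumes D: "1 \<le> D" and d: "1 \<le> d" and dbl: "doubling D C d" and T: "finite T" "T \<subseteq> C" and x: "x \<in> T"
    and ab: "a \<in> vecs D" "b \<in> vecs D" and r: "0 < r"
    and y: "y \<in> T \<inter> vball D a r" and y': "y' \<in> T \<inter> vball D b r"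
    and far: "7200 * d * r \<le> vdist D y y'" and R: "diam_le D T R"
  shows "measure (split_noise D) {n \<in> space (split_noise D). touches D a b r (split_cell D T x n True)} +
    measure (split_noise D) {n \<in> space (split_noise D). touches D a b r (split_cell D T x n False)}
    \<le> 1 - vdist D y y' / (720 * R)" (is "measure _ ?E1 + measure _ ?E2 \<le> _")
proof -
  interpret prob_space "gaussian D" using D by (rule prob_space_gaussian)
  interpret u: prob_space unif by (rule prob_space_unif)
  define \<Delta> where "\<Delta> = Max ((\<lambda>y. vdist D x y) ` T)"
  \<comment> \<open>Half of the half-width \<open>w\<close> of the window. If the projections of
    \<open>y\<close>, \<open>y'\<close> and the median are all within \<open>h\<close> of that of
    \<open>x\<close>, then the window contains both projections.\<close>
  define h where "h = 3 * \<Delta> / sqrt D"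
  define w where "w = 6 * \<Delta> / sqrt D"
  define \<sigma> where "\<sigma> = vdist D y y' / sqrt D"
  define m where "m = (\<lambda>v. median (image_mset (\<lambda>z. vinner D z v) (mset_set T)))"
  define X where "X = (\<lambda>y z v. vinner D y v - vinner D z v)"
  have sqrtD: "0 < sqrt D" using D by simp
  have \<Delta>_ge: "vdist D x z \<le> \<Delta>" if "z \<in> T" for z
    unfolding \<Delta>_def using T(1) that by (intro Max_ge) auto
  have "\<Delta> \<in> (\<lambda>y. vdist D x y) ` T" unfolding \<Delta>_def using T(1) x by (intro Max_in) auto
  then have \<Delta>_le: "\<Delta> \<le> R" using R x by (auto simp: diam_le_def)
  have "0 < 7200 * d * r" using d r by simp
  then have yy': "0 < vdist D y y'" using far by linarith
  have "vdist D y y' \<le> 2 * \<Delta>"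
    using vdist_triangle[of D y y' x] \<Delta>_ge[of y] \<Delta>_ge[of y'] y y' by (simp add: vdist_commute[of D y x])
  then have \<Delta>: "0 < \<Delta>" using yy' by linarith
  have h: "0 < h" and w: "0 < w" and wh: "w = 2 * h" and \<sigma>: "0 < \<sigma>"
    using \<Delta> sqrtD yy' by (auto simp: h_def w_def \<sigma>_def)
  have fin: "finite (T \<inter> vball D c r)" and sub: "T \<inter> vball D c r \<subseteq> vball D c r \<inter> C" for c using T by auto
  obtain F where F: "integrable (gaussian D) F" "\<And>v. 0 \<le> F v"
    "\<And>v z. z \<in> T \<inter> vball D a r \<Longrightarrow> \<bar>vinner D z v - vinner D a v\<bar> \<le> F v"
    "(\<integral>v. F v \<partial>gaussian D) \<le> 30 * r * d / sqrt D"
    using chaining[OF D d dbl ab(1) r fin sub] by blast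
  obtain F' where F': "integrable (gaussian D) F'" "\<And>v. 0 \<le> F' v"
    "\<And>v z. z \<in> T \<inter> vball D b r \<Longrightarrow> \<bar>vinner D z v - vinner D b v\<bar> \<le> F' v"
    "(\<integral>v. F' v \<partial>gaussian D) \<le> 30 * r * d / sqrt D"
    using chaining[OF D d dbl ab(2) r fin sub] by blast
  define A where "A = (\<lambda>v. \<bar>vinner D y v - m v\<bar> \<le> w \<and> \<bar>vinner D y' v - m v\<bar> \<le> w)"
  \<comment> \<open>Chebyshev terms for \<open>y\<close> and \<open>y'\<close>, and a Markov term
    for the median: it can stray only if at least half of \<open>T\<close> does, hence the factor
    \<open>2 / card T\<close>.\<close>
  define P where "P = (\<lambda>v. ((X y x v)\<^sup>2 + (X y' x v)\<^sup>2 + 2 / card T * (\<Sum>z\<in>T. (X z x v)\<^sup>2)) / h\<^sup>2)"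
  \<comment> \<open>an integrable majorant of the expected number of surviving children given the direction\<close>
  define H where "H = (\<lambda>v. 1 + (2 * F v + 2 * F' v -
      (\<bar>X y y' v\<bar> - (X y y' v)\<^sup>2 / (3 * \<sigma>) - 3 * \<sigma> / 4 * P v)) / (2 * w))"
  have cell: "split_cell D T x (v, u) l = {y \<in> T. vinner D y v < m v + u * w \<longleftrightarrow> l}" for v u l
    by (simp add: split_cell_def Let_def m_def w_def \<Delta>_def)
  have cardT: "0 < card T" using T(1) x by (auto simp: card_gt_0_iff)
  have P0: "0 \<le> P v" for v unfolding P_def by (intro divide_nonneg_nonneg add_nonneg_nonneg mult_nonneg_nonneg sum_nonneg) auto
  have sq1: "1 \<le> t\<^sup>2 / h\<^sup>2" if "h < \<bar>t\<bar>" for t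
  proof -
    have "h\<^sup>2 \<le> t\<^sup>2" using that h by (intro abs_le_square_iff[THEN iffD1]) simp
    then show ?thesis using h by (simp add: le_divide_eq)
  qed
  have P1: "1 \<le> P v" if nA: "\<not> A v" for v
  proof -
    have P_eq: "P v = (X y x v)\<^sup>2 / h\<^sup>2 + (X y' x v)\<^sup>2 / h\<^sup>2 + 2 / card T * (\<Sum>z\<in>T. (X z x v)\<^sup>2 / h\<^sup>2)"
      by (simp add: P_def add_divide_distrib sum_divide_distrib[symmetric])
    have nn: "0 \<le> (X y x v)\<^sup>2 / h\<^sup>2" "0 \<le> (X y' x v)\<^sup>2 / h\<^sup>2"
      "0 \<le> 2 / card T * (\<Sum>z\<in>T. (X z x v)\<^sup>2 / h\<^sup>2)"
      by (simp_all add: sum_nonneg)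
    from nA consider "h < \<bar>X y x v\<bar>" | "h < \<bar>X y' x v\<bar>" | "h < \<bar>m v - vinner D x v\<bar>"
      unfolding A_def wh X_def by linarith
    then show ?thesis
    proof cases
      case 1
      then show ?thesis using sq1[OF 1] nn unfolding P_eq by linarith
    next
      case 2
      then show ?thesis using sq1[OF 2] nn unfolding P_eq by linarith
    next
      case 3
      let ?B = "{z \<in> T. h < \<bar>vinner D z v - vinner D x v\<bar>}"
      have "\<not> 2 * card ?B < card T"
        using median_near[OF T(1), of h "\<lambda>z. vinner D z v" "vinner D x v"] 3 x unfolding m_def by force
      then have "real (card T) \<le> real (2 * card ?B)" unfolding of_nat_le_iff by simp
      then have "1 \<le> 2 / card T * card ?B" using cardT by (simp add: le_divide_eq)
      also have "real (card ?B) \<le> (\<Sum>z\<in>?B. (X z x v)\<^sup>2 / h\<^sup>2)"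
        using sum_bounded_below[of ?B 1 "\<lambda>z. (X z x v)\<^sup>2 / h\<^sup>2"] sq1 by (simp add: X_def)
      also have "\<dots> \<le> (\<Sum>z\<in>T. (X z x v)\<^sup>2 / h\<^sup>2)"
        using T(1) by (intro sum_mono2) auto
      finally have "1 \<le> 2 / card T * (\<Sum>z\<in>T. (X z x v)\<^sup>2 / h\<^sup>2)" by (simp add: divide_right_mono)
      then show ?thesis using nn unfolding P_eq by linarith
    qed
  qed
  have pointwise: "measure unif (Pair v -` ?E1) + measure unif (Pair v -` ?E2) \<le> H v" for v
  proof -
    define p where "p = vinner D y v"
    define p' where "p' = vinner D y' v"
    \<comment> \<open>\<open>F\<close> bounds deviations from the centre \<open>a\<close>. Comparing
      two points of the same cluster uses it twice, hence \<open>2 * F v\<close> around the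
      projection of \<open>y\<close>, and likewise for \<open>F'\<close>.\<close>
    define \<alpha> where "\<alpha> = max (p - 2 * F v) (p' - 2 * F' v)"
    define \<beta> where "\<beta> = min (p + 2 * F v) (p' + 2 * F' v)"
    have 1: "\<bar>vinner D z v - p\<bar> \<le> 2 * F v" if "z \<in> T \<inter> vball D a r" for z
      using F(3)[OF that, of v] F(3)[OF y, of v] unfolding p_def by linarith
    have 2: "\<bar>vinner D z v - p'\<bar> \<le> 2 * F' v" if "z \<in> T \<inter> vball D b r" for z
      using F'(3)[OF that, of v] F'(3)[OF y', of v] unfolding p'_def by linarith
    have "Pair v -` ?E1 \<subseteq> {(\<alpha> - m v) / w<..}"
    proof
      fix u assume "u \<in> Pair v -` ?E1"
      then obtain z z' where z: "z \<in> T \<inter> vball D a r" "vinner D z v < m v + u * w"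
        and z': "z' \<in> T \<inter> vball D b r" "vinner D z' v < m v + u * w"
        unfolding touches_def by (auto simp: cell)
      have "\<alpha> < m v + u * w" using 1[OF z(1)] 2[OF z'(1)] z(2) z'(2) unfolding \<alpha>_def by linarith
      then show "u \<in> {(\<alpha> - m v) / w<..}" using w by (simp add: divide_less_eq)
    qed
    then have m1: "measure unif (Pair v -` ?E1) \<le> 1 - unif_cdf ((\<alpha> - m v) / w)"
      unfolding measure_unif_greaterThan[symmetric] by (rule u.finite_measure_mono) simp
    have "Pair v -` ?E2 \<subseteq> {..(\<beta> - m v) / w}"
    proof
      fix u assume "u \<in> Pair v -` ?E2"
      then obtain z z' where z: "z \<in> T \<inter> vball D a r" "\<not> vinner D z v < m v + u * w"
        and z': "z' \<in> T \<inter> vball D b r" "\<not> vinner D z' v < m v + u * w"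
        unfolding touches_def by (auto simp: cell)
      have "m v + u * w \<le> \<beta>" using 1[OF z(1)] 2[OF z'(1)] z(2) z'(2) unfolding \<beta>_def by linarith
      then show "u \<in> {..(\<beta> - m v) / w}" using w by (simp add: le_divide_eq)
    qed
    then have m2: "measure unif (Pair v -` ?E2) \<le> unif_cdf ((\<beta> - m v) / w)"
      unfolding measure_unif_atMost[symmetric] by (rule u.finite_measure_mono) simp
    have "unif_cdf ((\<beta> - m v) / w) - unif_cdf ((\<alpha> - m v) / w) \<le>
        (2 * F v + 2 * F' v - (if \<bar>p - m v\<bar> \<le> w \<and> \<bar>p' - m v\<bar> \<le> w then \<bar>p - p'\<bar> else 0)) / (2 * w)"
      using F(2)[of v] F'(2)[of v] by (intro unif_cdf_gap w) (auto simp: \<alpha>_def \<beta>_def)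
    also have "\<dots> = (2 * F v + 2 * F' v - (if A v then \<bar>X y y' v\<bar> else 0)) / (2 * w)"
      by (simp add: A_def X_def p_def p'_def)
    also have "\<dots> \<le> (2 * F v + 2 * F' v -
        (\<bar>X y y' v\<bar> - (X y y' v)\<^sup>2 / (3 * \<sigma>) - 3 * \<sigma> / 4 * P v)) / (2 * w)"
      using w P1 P0 by (intro divide_right_mono diff_left_mono window_loss \<sigma>) auto
    finally show ?thesis using m1 m2 unfolding H_def by linarith
  qed
  have sq: "integrable (gaussian D) (\<lambda>v. (X y z v)\<^sup>2)"
    "(\<integral>v. (X y z v)\<^sup>2 \<partial>gaussian D) = (vdist D y z)\<^sup>2 / D" for y z
    unfolding X_def using gaussian_sq[OF D] by auto
  \<comment> \<open>With \<open>h = 3 * \<Delta> / sqrt D\<close> each second moment is a ninth of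
    the squared threshold; the weights \<open>1\<close>, \<open>1\<close>, \<open>2\<close> in
    \<open>P\<close> then add up to \<open>4/9\<close>.\<close>
  have sqx: "(\<integral>v. (X z x v)\<^sup>2 \<partial>gaussian D) \<le> h\<^sup>2 / 9" if "z \<in> T" for z
  proof -
    have "(vdist D z x)\<^sup>2 \<le> \<Delta>\<^sup>2"
      using \<Delta>_ge[OF that] by (intro power_mono) (auto simp: vdist_commute[of D z x])
    then show ?thesis unfolding sq(2) h_def using sqrtD by (simp add: power_divide power_mult_distrib divide_right_mono)
  qed
  have Pint: "integrable (gaussian D) P"
    unfolding P_def
    by (intro integrable_divide Bochner_Integration.integrable_add integrable_mult_right Bochner_Integration.integrable_sum sq)
  have EP: "(\<integral>v. P v \<partial>gaussian D) \<le> 4 / 9"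
  proof -
    have "(\<integral>v. P v \<partial>gaussian D) = ((\<integral>v. (X y x v)\<^sup>2 \<partial>gaussian D) + (\<integral>v. (X y' x v)\<^sup>2 \<partial>gaussian D) +
        2 / card T * (\<Sum>z\<in>T. \<integral>v. (X z x v)\<^sup>2 \<partial>gaussian D)) / h\<^sup>2"
      unfolding P_def by (simp add: sq(1))
    also have "\<dots> \<le> (h\<^sup>2 / 9 + h\<^sup>2 / 9 + 2 / card T * (\<Sum>z\<in>T. h\<^sup>2 / 9)) / h\<^sup>2"
      using y y' by (intro divide_right_mono add_mono mult_left_mono sum_mono sqx) auto
    also have "\<dots> = 4 / 9" using h cardT by (simp add: field_simps)
    finally show ?thesis .
  qed
  have Xint: "integrable (gaussian D) (\<lambda>v. \<bar>X y y' v\<bar>)"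
    unfolding X_def by (rule gaussian_abs(1)[OF D])
  have EX: "7 / 10 * \<sigma> \<le> (\<integral>v. \<bar>X y y' v\<bar> \<partial>gaussian D)"
  proof -
    have "(7 / 10)\<^sup>2 \<le> 2 / pi" using pi_less_4 by (simp add: le_divide_eq power2_eq_square)
    then have "7 / 10 \<le> sqrt (2 / pi)" by (rule real_le_rsqrt)
    then show ?thesis unfolding X_def gaussian_abs(2)[OF D] \<sigma>_def[symmetric]
      using \<sigma> by (intro mult_right_mono) auto
  qed
  have EX2: "(\<integral>v. (X y y' v)\<^sup>2 \<partial>gaussian D) = \<sigma>\<^sup>2"
    unfolding sq(2) \<sigma>_def by (simp add: power_divide)
  have Hint: "integrable (gaussian D) H"
    unfolding H_def using F(1) F'(1) Pint Xint sq(1) by simp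
  have "(\<integral>v. H v \<partial>gaussian D) = 1 + (2 * (\<integral>v. F v \<partial>gaussian D) + 2 * (\<integral>v. F' v \<partial>gaussian D) -
      ((\<integral>v. \<bar>X y y' v\<bar> \<partial>gaussian D) - \<sigma>\<^sup>2 / (3 * \<sigma>) - 3 * \<sigma> / 4 * (\<integral>v. P v \<partial>gaussian D))) / (2 * w)"
    unfolding H_def EX2[symmetric] using F(1) F'(1) Pint Xint sq(1) by (simp add: prob_space)
  also have "\<dots> \<le> 1 + (2 * (30 * r * d / sqrt D) + 2 * (30 * r * d / sqrt D) -
      (7 / 10 * \<sigma> - \<sigma>\<^sup>2 / (3 * \<sigma>) - 3 * \<sigma> / 4 * (4 / 9))) / (2 * w)"
    using w \<sigma> F(4) F'(4) EX EP
    by (intro add_left_mono divide_right_mono diff_mono add_mono mult_left_mono) auto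
  also have "\<dots> = 1 + (120 * r * d / sqrt D - \<sigma> / 30) / (2 * w)"
    using \<sigma> by (simp add: power2_eq_square)
  also have "\<dots> \<le> 1 + (\<sigma> / 60 - \<sigma> / 30) / (2 * w)"
  proof (intro add_left_mono divide_right_mono diff_right_mono)
    have "120 * r * d \<le> vdist D y y' / 60" using far by (simp add: mult_ac)
    then have "120 * r * d / sqrt D \<le> vdist D y y' / 60 / sqrt D" using sqrtD by (intro divide_right_mono) auto
    then show "120 * r * d / sqrt D \<le> \<sigma> / 60" by (simp add: \<sigma>_def)
  qed (use w in simp)
  also have "\<dots> = 1 - vdist D y y' / (720 * \<Delta>)"
    using \<Delta> sqrtD by (simp add: \<sigma>_def w_def field_simps)
  \<comment> \<open>\<open>\<Delta>\<close> depends on the picked point; passing to \<open>R\<close>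
    makes the bound uniform over all picks.\<close>
  also have "\<dots> \<le> 1 - vdist D y y' / (720 * R)"
    using \<Delta> \<Delta>_le yy' by (intro diff_left_mono divide_left_mono) auto
  finally have EH: "(\<integral>v. H v \<partial>gaussian D) \<le> 1 - vdist D y y' / (720 * R)" .
  have E: "?E1 \<in> sets (split_noise D)" "?E2 \<in> sets (split_noise D)"
    using split_cell_measurable[OF T(1)] by auto
  have "measure (split_noise D) ?E1 + measure (split_noise D) ?E2 =
      (\<integral>v. measure unif (Pair v -` ?E1) + measure unif (Pair v -` ?E2) \<partial>gaussian D)"
    by (simp only: measure_split_noise[OF D E(1)] measure_split_noise[OF D E(2)] Bochner_Integration.integral_add)
  also have "\<dots> \<le> (\<integral>v. H v \<partial>gaussian D)"
    by (intro integral_mono Hint pointwise Bochner_Integration.integrable_add measure_split_noise(1)[OF D] E)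
  finally show ?thesis using EH by linarith
qed

section \<open>The random tree\<close>

lemma prob_space_split_noise: "1 \<le> D \<Longrightarrow> prob_space (split_noise D)"
  unfolding split_noise_def by (intro prob_space_pair prob_space_gaussian prob_space_unif)

lemma prob_space_tree_noise: "1 \<le> D \<Longrightarrow> prob_space (tree_noise D N)"
  unfolding tree_noise_def by (intro prob_space_PiM prob_space_split_noise)

lemma proper_ancestors_Cons: "proper_ancestors (b # p) = insert p (proper_ancestors p)"
  by (auto simp: proper_ancestors_def strict_suffix_def suffix_Cons dest: suffix_length_le)

lemma not_in_proper_ancestors: "p \<notin> proper_ancestors p"
  by (simp add: proper_ancestors_def)

lemma proper_ancestors_append: "proper_ancestors p \<subseteq> proper_ancestors (r @ p)"
  by (induction r) (auto simp: proper_ancestors_Cons)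

text \<open>The recursion reads noise only at nodes strictly above \<open>p\<close>, and picks see
  only a restricted history. This locality is the source of the independence used later.\<close>

lemma cell_cong:
  assumes "\<And>n. n \<in> proper_ancestors p \<Longrightarrow> \<omega> n = \<omega>' n"
  shows "cell D S pick \<omega> p = cell D S pick \<omega>' p"
  using assms
proof (induction p)
  case (Cons b p)
  have eq: "cell D S pick \<omega> p = cell D S pick \<omega>' p"
    by (rule Cons.IH) (simp add: Cons.prems proper_ancestors_Cons)
  have "restrict \<omega> (proper_ancestors p) = restrict \<omega>' (proper_ancestors p)"
    using Cons.prems by (auto simp: proper_ancestors_Cons restrict_def)
  moreover have "\<omega> p = \<omega>' p" using Cons.prems by (simp add: proper_ancestors_Cons)
  ultimately show ?case by (simp only: cell.simps eq)
qed simp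

lemma cell_append_subset: "cell D S pick \<omega> (r @ p) \<subseteq> cell D S pick \<omega> p"
proof (induction r)
  case (Cons b r)
  have "cell D S pick \<omega> ((b # r) @ p) \<subseteq> cell D S pick \<omega> (r @ p)"
    by (simp add: Let_def split_cell_subset)
  then show ?case using Cons by (rule subset_trans)
qed simp

lemma cell_subset: "cell D S pick \<omega> p \<subseteq> S"
  using cell_append_subset[of D S pick \<omega> p "[]"] by simp

lemma split_cell_empty: "split_cell D {} x n b = {}"
  using split_cell_subset[of D "{}" x n b] by simp

lemma valid_pick_measurable:
  assumes "valid_pick D S pick" "T \<subseteq> S" "x \<in> T" "proper_ancestors p \<subseteq> N"
  shows "{\<omega> \<in> space (tree_noise D N). pick p (restrict \<omega> (proper_ancestors p)) T = x} \<in> sets (tree_noise D N)"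
proof -
  have "(\<lambda>h. pick p h T) \<in> measurable (tree_noise D (proper_ancestors p)) (count_space T)"
    using assms unfolding valid_pick_def by blast
  moreover have "(\<lambda>\<omega>. restrict \<omega> (proper_ancestors p)) \<in> measurable (tree_noise D N) (tree_noise D (proper_ancestors p))"
    unfolding tree_noise_def using assms(4) by (rule measurable_restrict_subset)
  ultimately have "(\<lambda>\<omega>. pick p (restrict \<omega> (proper_ancestors p)) T) \<in> measurable (tree_noise D N) (count_space T)"
    by (rule measurable_compose[rotated])
  from measurable_sets[OF this, of "{x}"] assms(3) show ?thesis
    by (simp add: vimage_def Int_def conj_commute)
qed

lemma valid_pick_in:
  assumes "valid_pick D S pick" "T \<subseteq> S" "T \<noteq> {}" "h \<in> space (tree_noise D (proper_ancestors p))"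
  shows "pick p h T \<in> T"
proof -
  have "(\<lambda>h. pick p h T) \<in> measurable (tree_noise D (proper_ancestors p)) (count_space T)"
    using assms unfolding valid_pick_def by blast
  from measurable_space[OF this assms(4)] show ?thesis by simp
qed

lemma restrict_in_space_tree_noise:
  "\<omega> \<in> space (tree_noise D N) \<Longrightarrow> N' \<subseteq> N \<Longrightarrow> restrict \<omega> N' \<in> space (tree_noise D N')"
  unfolding tree_noise_def space_PiM by auto

text \<open>The picked point is itself random. Fixing both the parent's data and the pick leaves a
  condition on a single noise coordinate, and only finitely many such combinations exist.\<close>

lemma cell_eq_measurable:
  assumes "finite S" "valid_pick D S pick" "proper_ancestors p \<subseteq> N"
  shows "{\<omega> \<in> space (tree_noise D N). cell D S pick \<omega> p = T} \<in> sets (tree_noise D N)"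
  using assms(3)
proof (induction p arbitrary: T)
  case Nil
  show ?case by (cases "S = T") auto
next
  case (Cons b p)
  let ?M = "tree_noise D N"
  let ?x = "\<lambda>\<omega> T. pick p (restrict \<omega> (proper_ancestors p)) T"
  have anc: "proper_ancestors p \<subseteq> N" "p \<in> N" using Cons.prems by (auto simp: proper_ancestors_Cons)
  have coord: "(\<lambda>\<omega>. \<omega> p) \<in> measurable ?M (split_noise D)"
    unfolding tree_noise_def using anc(2) by (rule measurable_component_singleton)
  have split: "{\<omega> \<in> space ?M. split_cell D T' x (\<omega> p) b = T} \<in> sets ?M" if "T' \<subseteq> S" for T' x
  proof -
    have T': "finite T'" using that assms(1) by (rule finite_subset)
    have "(\<lambda>\<omega>. \<omega> p) -` {n \<in> space (split_noise D). split_cell D T' x n b = T} \<inter> space ?M \<in> sets ?M"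
      by (rule measurable_sets[OF coord split_cell_measurable[OF T']])
    also have "(\<lambda>\<omega>. \<omega> p) -` {n \<in> space (split_noise D). split_cell D T' x n b = T} \<inter> space ?M =
        {\<omega> \<in> space ?M. split_cell D T' x (\<omega> p) b = T}"
      using measurable_space[OF coord] by auto
    finally show ?thesis .
  qed
  define B where "B = (\<lambda>T' x. {\<omega> \<in> space ?M. cell D S pick \<omega> p = T'} \<inter> {\<omega> \<in> space ?M. ?x \<omega> T' = x} \<inter>
        {\<omega> \<in> space ?M. split_cell D T' x (\<omega> p) b = T})"
  \<comment> \<open>\<open>valid_pick\<close> says nothing about an empty cell; there the child is
    empty whatever the pick is.\<close>
  define B0 where "B0 = {\<omega> \<in> space ?M. cell D S pick \<omega> p = {} \<and> T = {}}"
  have "{\<omega> \<in> space ?M. cell D S pick \<omega> (b # p) = T} = B0 \<union> (\<Union>T'\<in>Pow S. \<Union>x\<in>T'. B T' x)"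
  proof (rule antisym; rule subsetI)
    fix \<omega> assume \<omega>: "\<omega> \<in> {\<omega> \<in> space ?M. cell D S pick \<omega> (b # p) = T}"
    define T' where "T' = cell D S pick \<omega> p"
    have T': "T' \<subseteq> S" unfolding T'_def by (rule cell_subset)
    show "\<omega> \<in> B0 \<union> (\<Union>T'\<in>Pow S. \<Union>x\<in>T'. B T' x)"
    proof (cases "T' = {}")
      case True
      then have "\<omega> \<in> B0" using \<omega> by (simp add: B0_def T'_def[symmetric] split_cell_empty)
      then show ?thesis by blast
    next
      case False
      have "?x \<omega> T' \<in> T'"
        using \<omega> anc(1) by (intro valid_pick_in[OF assms(2) T' False] restrict_in_space_tree_noise) auto
      moreover have "\<omega> \<in> B T' (?x \<omega> T')"
        using \<omega> by (simp add: B_def T'_def Let_def)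
      ultimately show ?thesis using T' by blast
    qed
  next
    fix \<omega> assume "\<omega> \<in> B0 \<union> (\<Union>T'\<in>Pow S. \<Union>x\<in>T'. B T' x)"
    then consider "\<omega> \<in> B0" | T' x where "\<omega> \<in> B T' x" by blast
    then show "\<omega> \<in> {\<omega> \<in> space ?M. cell D S pick \<omega> (b # p) = T}"
      by cases (simp_all add: B0_def B_def Let_def split_cell_empty)
  qed
  moreover have "B0 \<union> (\<Union>T'\<in>Pow S. \<Union>x\<in>T'. B T' x) \<in> sets ?M"
  proof (rule sets.Un)
    show "B0 \<in> sets ?M"
      unfolding B0_def using Cons.IH[OF anc(1), of "{}"] by (cases "T = {}") auto
    show "(\<Union>T'\<in>Pow S. \<Union>x\<in>T'. B T' x) \<in> sets ?M"
    proof (intro sets.finite_UN)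
      show "finite (Pow S)" using assms(1) by simp
      fix T' x assume T': "T' \<in> Pow S"
      then show "finite T'" using assms(1) by (auto intro: finite_subset)
      assume "x \<in> T'"
      then show "B T' x \<in> sets ?M"
        unfolding B_def using T'
        by (intro sets.Int Cons.IH[OF anc(1)] valid_pick_measurable[OF assms(2) _ _ anc(1)] split) auto
    qed
  qed
  ultimately show ?case by simp
qed

lemma cell_measurable:
  assumes "finite S" "valid_pick D S pick" "proper_ancestors p \<subseteq> N"
  shows "{\<omega> \<in> space (tree_noise D N). Q (cell D S pick \<omega> p)} \<in> sets (tree_noise D N)"
proof -
  have "(\<Union>T\<in>{T \<in> Pow S. Q T}. {\<omega> \<in> space (tree_noise D N). cell D S pick \<omega> p = T}) \<in> sets (tree_noise D N)"
    using assms(1) by (intro sets.finite_UN cell_eq_measurable[OF assms]) auto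
  also have "(\<Union>T\<in>{T \<in> Pow S. Q T}. {\<omega> \<in> space (tree_noise D N). cell D S pick \<omega> p = T}) =
      {\<omega> \<in> space (tree_noise D N). Q (cell D S pick \<omega> p)}"
    using cell_subset[of D S pick _ p] by auto
  finally show ?thesis .
qed

text \<open>All noise outside the subtree is frozen in \<open>\<omega>\<^sub>0\<close>. It
  determines the cell at \<open>q\<close>, so \<open>C\<close> is a constant and only the noise from
  \<open>q\<close> downwards is random.\<close>

locale rp_subtree =
  fixes D :: nat and S :: "vec set" and pick :: pick_rule and q :: node and \<omega>\<^sub>0 :: "node \<Rightarrow> noise"
  assumes D: "1 \<le> D" and S: "finite S" "S \<subseteq> vecs D" and pick: "valid_pick D S pick"
    and \<omega>\<^sub>0: "\<omega>\<^sub>0 \<in> space (tree_noise D (- subtree q))"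
begin

abbreviation "M \<equiv> tree_noise D (subtree q)"
abbreviation "C \<equiv> cell D S pick \<omega>\<^sub>0 q"

sublocale prob_space M using D by (rule prob_space_tree_noise)

definition desc :: "node \<Rightarrow> (node \<Rightarrow> noise) \<Rightarrow> vec set" where
  "desc p \<omega> = cell D S pick (override_on \<omega>\<^sub>0 \<omega> (subtree q)) (p @ q)"

text \<open>What the pick at \<open>n\<close> may see, as a point of the space on which
  \<open>valid_pick\<close> gives measurability: frozen noise outside the subtree, fresh noise
  inside.\<close>

definition hist :: "node \<Rightarrow> (node \<Rightarrow> noise) \<Rightarrow> node \<Rightarrow> noise" where
  "hist n \<omega> = restrict (override_on \<omega>\<^sub>0 \<omega> (subtree q)) (proper_ancestors n)"

lemma in_subtree: "p @ q \<in> subtree q"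
  by (simp add: subtree_def suffix_def)

lemma desc_Nil: "desc [] \<omega> = C"
  unfolding desc_def append_Nil
  by (rule cell_cong) (auto simp: override_on_def proper_ancestors_def subtree_def strict_suffix_def
      dest: suffix_order.antisym)

lemma desc_append_subset: "desc (r @ p) \<omega> \<subseteq> desc p \<omega>"
  unfolding desc_def append_assoc by (rule cell_append_subset)

lemma desc_subset: "desc p \<omega> \<subseteq> C"
  using desc_append_subset[of p "[]" \<omega>] by (simp add: desc_Nil)

lemma desc_drop_subset: "desc p \<omega> \<subseteq> desc (drop j p) \<omega>"
  using desc_append_subset[of "take j p" "drop j p" \<omega>] by simp

lemma C_props: "C \<subseteq> S" "finite C" "C \<subseteq> vecs D"
  using cell_subset S finite_subset[OF cell_subset S(1)] by blast+

text \<open>The history of a lower node determines all cells above it, so one history carries both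
  the cell being split and the ancestor tested by \<open>Q\<close>.\<close>

lemma desc_hist: "desc p \<omega> = cell D S pick (hist (r @ p @ q) \<omega>) (p @ q)"
  unfolding desc_def hist_def
  by (rule cell_cong) (use proper_ancestors_append[of "p @ q" r] in auto)

lemma desc_Cons:
  "desc (b # p) \<omega> = split_cell D (desc p \<omega>) (pick (p @ q) (hist (p @ q) \<omega>) (desc p \<omega>)) (\<omega> (p @ q)) b"
  using in_subtree[of p] by (simp add: desc_def hist_def Let_def override_on_def)

lemma hist_measurable:
  assumes "N \<subseteq> subtree q" "proper_ancestors n \<inter> subtree q \<subseteq> N"
  shows "hist n \<in> measurable (tree_noise D N) (tree_noise D (proper_ancestors n))"
  unfolding tree_noise_def hist_def
proof (rule measurable_restrict)
  fix i assume i: "i \<in> proper_ancestors n"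
  show "(\<lambda>\<omega>. override_on \<omega>\<^sub>0 \<omega> (subtree q) i) \<in> measurable (PiM N (\<lambda>_. split_noise D)) (split_noise D)"
  proof (cases "i \<in> subtree q")
    case True
    then show ?thesis using i assms by (auto simp: override_on_def intro!: measurable_component_singleton)
  next
    case False
    then have "\<omega>\<^sub>0 i \<in> space (split_noise D)"
      using \<omega>\<^sub>0 by (auto simp: tree_noise_def space_PiM)
    then show ?thesis using False by (simp add: override_on_def)
  qed
qed

lemma desc_measurable: "{\<omega> \<in> space M. Q (desc p \<omega>)} \<in> sets M"
proof -
  have h: "hist (p @ q) \<in> measurable M (tree_noise D (proper_ancestors (p @ q)))"
    by (rule hist_measurable) auto
  have "hist (p @ q) -` {h \<in> space (tree_noise D (proper_ancestors (p @ q))). Q (cell D S pick h (p @ q))} \<inter> space M \<in> sets M"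
    by (rule measurable_sets[OF h cell_measurable[OF S(1) pick subset_refl]])
  also have "hist (p @ q) -` {h \<in> space (tree_noise D (proper_ancestors (p @ q))). Q (cell D S pick h (p @ q))} \<inter> space M =
      {\<omega> \<in> space M. Q (desc p \<omega>)}"
    using measurable_space[OF h] desc_hist[of p _ "[]"] by auto
  finally show ?thesis .
qed

text \<open>A node is not its own proper ancestor, so the history is a function of the coordinates
  other than \<open>n\<close>, which are independent of the coordinate \<open>n\<close>.\<close>

lemma hist_indep:
  assumes n: "n \<in> subtree q" and A: "A \<in> sets (tree_noise D (proper_ancestors n))" and E: "E \<in> sets (split_noise D)"
  shows "prob {\<omega> \<in> space M. hist n \<omega> \<in> A \<and> \<omega> n \<in> E} = prob {\<omega> \<in> space M. hist n \<omega> \<in> A} * measure (split_noise D) E"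
proof -
  let ?N = "subtree q - {n}"
  let ?M = "\<lambda>_. split_noise D"
  have "indep_vars ?M (\<lambda>i \<omega>. \<omega> i) (subtree q)"
    unfolding tree_noise_def using n prob_space_split_noise[OF D]
    by (intro indep_vars_PiM_coordinate) auto
  then have ind: "indep_var (PiM ?N ?M) (\<lambda>\<omega>. restrict (\<lambda>i. \<omega> i) ?N) (PiM {n} ?M) (\<lambda>\<omega>. restrict (\<lambda>i. \<omega> i) {n})"
    by (rule indep_var_restrict) (use n in auto)
  have h: "hist n \<in> measurable (PiM ?N ?M) (tree_noise D (proper_ancestors n))"
    using hist_measurable[of ?N n] not_in_proper_ancestors[of n] unfolding tree_noise_def by auto
  have A': "hist n -` A \<inter> space (PiM ?N ?M) \<in> sets (PiM ?N ?M)"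
    by (rule measurable_sets[OF h A])
  have c: "(\<lambda>f. f n) \<in> measurable (PiM {n} ?M) (split_noise D)"
    by (rule measurable_component_singleton) simp
  have E': "(\<lambda>f. f n) -` E \<inter> space (PiM {n} ?M) \<in> sets (PiM {n} ?M)"
    by (rule measurable_sets[OF c E])
  have r1: "restrict \<omega> ?N \<in> space (PiM ?N ?M)" and r2: "restrict \<omega> {n} \<in> space (PiM {n} ?M)"
    if "\<omega> \<in> space M" for \<omega>
    using restrict_in_space_tree_noise[OF that, of ?N] restrict_in_space_tree_noise[OF that, of "{n}"] n
    by (auto simp: tree_noise_def)
  have hr: "hist n (restrict \<omega> ?N) = hist n \<omega>" for \<omega>
    unfolding hist_def restrict_def override_on_def using not_in_proper_ancestors[of n] by (auto simp: fun_eq_iff)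
  have 1: "(\<lambda>\<omega>. (restrict \<omega> ?N, restrict \<omega> {n})) -`
        ((hist n -` A \<inter> space (PiM ?N ?M)) \<times> ((\<lambda>f. f n) -` E \<inter> space (PiM {n} ?M))) \<inter> space M =
      {\<omega> \<in> space M. hist n \<omega> \<in> A \<and> \<omega> n \<in> E}"
    using r1 r2 by (auto simp: hr)
  have 2: "(\<lambda>\<omega>. restrict \<omega> ?N) -` (hist n -` A \<inter> space (PiM ?N ?M)) \<inter> space M = {\<omega> \<in> space M. hist n \<omega> \<in> A}"
    using r1 by (auto simp: hr)
  have 3: "(\<lambda>\<omega>. restrict \<omega> {n}) -` ((\<lambda>f. f n) -` E \<inter> space (PiM {n} ?M)) \<inter> space M = (\<lambda>\<omega>. \<omega> n) -` E \<inter> space M"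
    using r2 by auto
  have "measure (split_noise D) E = measure (distr M (split_noise D) (\<lambda>\<omega>. \<omega> n)) E"
    unfolding tree_noise_def using n prob_space_split_noise[OF D] by (subst distr_PiM_component) auto
  also have "\<dots> = prob ((\<lambda>\<omega>. \<omega> n) -` E \<inter> space M)"
    unfolding tree_noise_def using n E by (intro measure_distr measurable_component_singleton)
  finally show ?thesis
    using indep_varD[OF ind A' E'] unfolding 1 2 3 by simp
qed

text \<open>Once the cell at \<open>p\<close> and its pick are fixed by the history, the child
  depends only on fresh noise, and \<open>split\<close> bounds the two child probabilities by
  \<open>\<kappa>\<close>. Assumption \<open>up\<close> says that only cells with
  \<open>\<tau>\<close> have such children, \<open>ne\<close> makes them nonempty so that the pick
  lies in the cell, and \<open>down\<close> carries \<open>Q\<close> from the ancestor to the cell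
  being split.\<close>

lemma split_step:
  assumes up: "\<And>T T'. \<tau> T' \<Longrightarrow> T' \<subseteq> T \<Longrightarrow> \<tau> T" and ne: "\<not> \<tau> {}"
    and down: "\<And>T T'. Q T \<Longrightarrow> T' \<subseteq> T \<Longrightarrow> Q T'"
    and split: "\<And>T x. T \<subseteq> C \<Longrightarrow> x \<in> T \<Longrightarrow> \<tau> T \<Longrightarrow> Q T \<Longrightarrow>
      measure (split_noise D) {n \<in> space (split_noise D). \<tau> (split_cell D T x n True)} +
      measure (split_noise D) {n \<in> space (split_noise D). \<tau> (split_cell D T x n False)} \<le> \<kappa>"
  shows "(\<Sum>l\<in>UNIV. prob {\<omega> \<in> space M. Q (desc (drop j p) \<omega>) \<and> \<tau> (desc (l # p) \<omega>)}) \<le>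
    \<kappa> * prob {\<omega> \<in> space M. Q (desc (drop j p) \<omega>) \<and> \<tau> (desc p \<omega>)}"
proof -
  let ?n = "p @ q"
  let ?A = "tree_noise D (proper_ancestors ?n)"
  \<comment> \<open>The possible values of cell and pick. Fixing them partitions the event that the
    parent satisfies \<open>\<tau>\<close> and its ancestor \<open>Q\<close>, so summing
    \<open>prob (W i)\<close> recovers that event exactly.\<close>
  define I where "I = {(T, x). T \<subseteq> C \<and> x \<in> T \<and> \<tau> T \<and> Q T}"
  define B where "B = (\<lambda>(T, x). {h \<in> space ?A. Q (cell D S pick h (drop j p @ q))} \<inter>
    {h \<in> space ?A. cell D S pick h ?n = T} \<inter> {h \<in> space ?A. pick ?n (restrict h (proper_ancestors ?n)) T = x})"
  define W where "W = (\<lambda>i. {\<omega> \<in> space M. hist ?n \<omega> \<in> B i})"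
  define E where "E = (\<lambda>l (T, x). {n \<in> space (split_noise D). \<tau> (split_cell D T x n l)})"
  have finI: "finite I"
    by (rule finite_subset[of _ "Pow C \<times> C"]) (use C_props(2) in \<open>auto simp: I_def\<close>)
  have B: "B i \<in> sets ?A" if "i \<in> I" for i
  proof -
    obtain T x where i: "i = (T, x)" "T \<subseteq> S" "x \<in> T"
      using \<open>i \<in> I\<close> C_props(1) unfolding I_def by blast
    have "proper_ancestors (drop j p @ q) \<subseteq> proper_ancestors ?n"
      using proper_ancestors_append[of "drop j p @ q" "take j p"]
      unfolding append_assoc[symmetric] append_take_drop_id .
    then show ?thesis unfolding B_def i(1) prod.case
      by (intro sets.Int cell_measurable[OF S(1) pick] valid_pick_measurable[OF pick i(2,3)]) auto
  qed
  have E: "E l i \<in> sets (split_noise D)" if "i \<in> I" for l i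
  proof -
    obtain T x where i: "i = (T, x)" "T \<subseteq> C" using \<open>i \<in> I\<close> unfolding I_def by blast
    show ?thesis unfolding E_def i(1) prod.case
      using finite_subset[OF i(2) C_props(2)] by (rule split_cell_measurable)
  qed
  have h: "hist ?n \<in> measurable M ?A" by (rule hist_measurable) auto
  have W: "W i \<in> sets M" if "i \<in> I" for i
  proof -
    have "W i = hist ?n -` B i \<inter> space M" by (auto simp: W_def)
    then show ?thesis using measurable_sets[OF h B[OF that]] by simp
  qed
  have coord: "(\<lambda>\<omega>. \<omega> ?n) \<in> measurable M (split_noise D)"
    unfolding tree_noise_def using in_subtree by (rule measurable_component_singleton)
  have WE: "{\<omega> \<in> space M. hist ?n \<omega> \<in> B i \<and> \<omega> ?n \<in> E l i} \<in> sets M" if "i \<in> I" for l i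
  proof -
    have "{\<omega> \<in> space M. hist ?n \<omega> \<in> B i \<and> \<omega> ?n \<in> E l i} = W i \<inter> ((\<lambda>\<omega>. \<omega> ?n) -` E l i \<inter> space M)"
      by (auto simp: W_def)
    then show ?thesis using W[OF that] measurable_sets[OF coord E[OF that]] by simp
  qed
  have hist_idem: "restrict (hist ?n \<omega>) (proper_ancestors ?n) = hist ?n \<omega>" for \<omega>
    by (simp add: hist_def)
  have desc_drop: "desc (drop j p) \<omega> = cell D S pick (hist ?n \<omega>) (drop j p @ q)" for \<omega>
    using desc_hist[of "drop j p" \<omega> "take j p"] by (simp add: append_assoc[symmetric] del: append_assoc)
  have desc_p: "desc p \<omega> = cell D S pick (hist ?n \<omega>) ?n" for \<omega>
    using desc_hist[of p \<omega> "[]"] by simp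
  have in_B: "hist ?n \<omega> \<in> B (T, x) \<longleftrightarrow>
      Q (desc (drop j p) \<omega>) \<and> desc p \<omega> = T \<and> pick ?n (hist ?n \<omega>) T = x" if "\<omega> \<in> space M" for \<omega> T x
    using measurable_space[OF h that] by (auto simp: B_def hist_idem desc_drop desc_p)
  have step: "prob {\<omega> \<in> space M. Q (desc (drop j p) \<omega>) \<and> \<tau> (desc (l # p) \<omega>)} \<le>
      (\<Sum>i\<in>I. prob (W i) * measure (split_noise D) (E l i))" for l
  proof -
    have "{\<omega> \<in> space M. Q (desc (drop j p) \<omega>) \<and> \<tau> (desc (l # p) \<omega>)} \<subseteq>
        (\<Union>i\<in>I. {\<omega> \<in> space M. hist ?n \<omega> \<in> B i \<and> \<omega> ?n \<in> E l i})"
    proof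
      fix \<omega> assume "\<omega> \<in> {\<omega> \<in> space M. Q (desc (drop j p) \<omega>) \<and> \<tau> (desc (l # p) \<omega>)}"
      then have \<omega>: "\<omega> \<in> space M" "Q (desc (drop j p) \<omega>)" "\<tau> (desc (l # p) \<omega>)" by auto
      define T where "T = desc p \<omega>"
      define x where "x = pick ?n (hist ?n \<omega>) T"
      have cell: "desc (l # p) \<omega> = split_cell D T x (\<omega> ?n) l" by (simp add: desc_Cons T_def x_def)
      have "\<tau> T" using up[OF \<omega>(3)] split_cell_subset unfolding cell by blast
      then have "T \<noteq> {}" using ne by blast
      have T: "T \<subseteq> C" unfolding T_def by (rule desc_subset)
      have "T \<subseteq> S" using T C_props(1) by simp
      then have "x \<in> T" unfolding x_def
        by (rule valid_pick_in[OF pick _ \<open>T \<noteq> {}\<close> measurable_space[OF h \<omega>(1)]])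
      moreover have "Q T" unfolding T_def using down[OF \<omega>(2) desc_drop_subset] .
      ultimately have "(T, x) \<in> I" using T \<open>\<tau> T\<close> by (simp add: I_def)
      moreover have "hist ?n \<omega> \<in> B (T, x)" using in_B[OF \<omega>(1)] \<omega>(2) by (simp add: T_def x_def)
      moreover have "\<omega> ?n \<in> E l (T, x)" using measurable_space[OF coord \<omega>(1)] \<omega>(3) by (simp add: E_def cell)
      ultimately show "\<omega> \<in> (\<Union>i\<in>I. {\<omega> \<in> space M. hist ?n \<omega> \<in> B i \<and> \<omega> ?n \<in> E l i})" using \<omega>(1) by blast
    qed
    then have "prob {\<omega> \<in> space M. Q (desc (drop j p) \<omega>) \<and> \<tau> (desc (l # p) \<omega>)} \<le>
        prob (\<Union>i\<in>I. {\<omega> \<in> space M. hist ?n \<omega> \<in> B i \<and> \<omega> ?n \<in> E l i})"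
      by (rule finite_measure_mono) (use finI WE in \<open>auto intro!: sets.finite_UN\<close>)
    also have "\<dots> \<le> (\<Sum>i\<in>I. prob {\<omega> \<in> space M. hist ?n \<omega> \<in> B i \<and> \<omega> ?n \<in> E l i})"
      by (rule finite_measure_subadditive_finite[OF finI]) (use WE in auto)
    also have "\<dots> = (\<Sum>i\<in>I. prob (W i) * measure (split_noise D) (E l i))"
      unfolding W_def by (intro sum.cong refl hist_indep in_subtree B E)
    finally show ?thesis .
  qed
  have disj: "disjoint_family_on W I"
    unfolding disjoint_family_on_def
  proof (intro ballI impI)
    fix i i' assume "i \<in> I" "i' \<in> I" "i \<noteq> i'"
    then show "W i \<inter> W i' = {}" by (cases i; cases i') (auto simp: W_def in_B)
  qed
  have "(\<Sum>l\<in>UNIV. prob {\<omega> \<in> space M. Q (desc (drop j p) \<omega>) \<and> \<tau> (desc (l # p) \<omega>)}) \<le>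
      (\<Sum>l\<in>UNIV. \<Sum>i\<in>I. prob (W i) * measure (split_noise D) (E l i))"
    by (rule sum_mono) (rule step)
  also have "\<dots> = (\<Sum>i\<in>I. prob (W i) * (measure (split_noise D) (E True i) + measure (split_noise D) (E False i)))"
    by (simp add: UNIV_bool sum.distrib[symmetric] distrib_left add.commute)
  also have "\<dots> \<le> (\<Sum>i\<in>I. prob (W i) * \<kappa>)"
    by (intro sum_mono mult_left_mono) (use split in \<open>auto simp: I_def E_def\<close>)
  also have "\<dots> = \<kappa> * prob (\<Union>i\<in>I. W i)"
    using finite_measure_finite_Union[OF finI _ disj] W by (simp add: sum_distrib_left[symmetric] mult.commute image_subset_iff)
  also have "(\<Union>i\<in>I. W i) = {\<omega> \<in> space M. Q (desc (drop j p) \<omega>) \<and> \<tau> (desc p \<omega>)}"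
  proof (intro equalityI subsetI)
    fix \<omega> assume "\<omega> \<in> (\<Union>i\<in>I. W i)"
    then show "\<omega> \<in> {\<omega> \<in> space M. Q (desc (drop j p) \<omega>) \<and> \<tau> (desc p \<omega>)}"
      by (auto simp: W_def in_B I_def)
  next
    fix \<omega> assume "\<omega> \<in> {\<omega> \<in> space M. Q (desc (drop j p) \<omega>) \<and> \<tau> (desc p \<omega>)}"
    then have \<omega>: "\<omega> \<in> space M" "Q (desc (drop j p) \<omega>)" "\<tau> (desc p \<omega>)" by auto
    define x where "x = pick ?n (hist ?n \<omega>) (desc p \<omega>)"
    have "desc p \<omega> \<noteq> {}" using \<omega>(3) ne by metis
    then have "x \<in> desc p \<omega>" unfolding x_def
      using desc_subset C_props(1) measurable_space[OF h \<omega>(1)] by (intro valid_pick_in[OF pick]) auto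
    then have "(desc p \<omega>, x) \<in> I"
      using desc_subset down[OF \<omega>(2) desc_drop_subset] \<omega>(3) by (simp add: I_def)
    moreover have "\<omega> \<in> W (desc p \<omega>, x)" using \<omega> by (simp add: W_def in_B x_def)
    ultimately show "\<omega> \<in> (\<Union>i\<in>I. W i)" by blast
  qed
  finally show ?thesis .
qed

section \<open>Expected numbers of surviving cells, level by level\<close>

lemma finite_level: "finite {p :: node. length p = k}"
  using finite_lists_length_eq[of "UNIV :: bool set" k] by simp

lemma sum_level_Suc: "(\<Sum>p | length p = Suc k. f p) = (\<Sum>p | length p = k. \<Sum>l\<in>UNIV. f (l # p))"
  for f :: "node \<Rightarrow> real"
proof -
  have "(\<Sum>p | length p = k. \<Sum>l\<in>UNIV. f (l # p)) = (\<Sum>(p, l)\<in>{p. length p = k} \<times> UNIV. f (l # p))"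
    by (rule sum.cartesian_product)
  also have "\<dots> = (\<Sum>p | length p = Suc k. f p)"
    by (rule sum.reindex_bij_witness[of _ "\<lambda>p. (tl p, hd p)" "\<lambda>(p, l). l # p"]) (auto simp: length_Suc_conv)
  finally show ?thesis by simp
qed

text \<open>Iterates \<open>split_step\<close> for \<open>j\<close> levels below level
  \<open>k\<close>. Prepending a turn while dropping one more entry leaves the tested ancestor at
  level \<open>k\<close> unchanged.\<close>

lemma expected_count:
  assumes up: "\<And>T T'. \<tau> T' \<Longrightarrow> T' \<subseteq> T \<Longrightarrow> \<tau> T" and ne: "\<not> \<tau> {}"
    and down: "\<And>T T'. Q T \<Longrightarrow> T' \<subseteq> T \<Longrightarrow> Q T'"
    and split: "\<And>T x. T \<subseteq> C \<Longrightarrow> x \<in> T \<Longrightarrow> \<tau> T \<Longrightarrow> Q T \<Longrightarrow>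
      measure (split_noise D) {n \<in> space (split_noise D). \<tau> (split_cell D T x n True)} +
      measure (split_noise D) {n \<in> space (split_noise D). \<tau> (split_cell D T x n False)} \<le> \<kappa>"
    and \<kappa>: "0 \<le> \<kappa>"
  shows "(\<Sum>p | length p = k + j. prob {\<omega> \<in> space M. Q (desc (drop j p) \<omega>) \<and> \<tau> (desc p \<omega>)}) \<le>
    \<kappa> ^ j * (\<Sum>p | length p = k. prob {\<omega> \<in> space M. \<tau> (desc p \<omega>)})"
proof (induction j)
  case 0
  have "prob {\<omega> \<in> space M. Q (desc p \<omega>) \<and> \<tau> (desc p \<omega>)} \<le> prob {\<omega> \<in> space M. \<tau> (desc p \<omega>)}" for p
    by (rule finite_measure_mono) (auto intro: desc_measurable)
  then show ?case by (simp add: sum_mono)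
next
  case (Suc j)
  have "(\<Sum>p | length p = k + Suc j. prob {\<omega> \<in> space M. Q (desc (drop (Suc j) p) \<omega>) \<and> \<tau> (desc p \<omega>)}) =
      (\<Sum>p | length p = k + j. \<Sum>l\<in>UNIV. prob {\<omega> \<in> space M. Q (desc (drop j p) \<omega>) \<and> \<tau> (desc (l # p) \<omega>)})"
    using sum_level_Suc[of "\<lambda>p. prob {\<omega> \<in> space M. Q (desc (drop (Suc j) p) \<omega>) \<and> \<tau> (desc p \<omega>)}" "k + j"]
    by (simp only: add_Suc_right drop_Suc_Cons)
  also have "\<dots> \<le> (\<Sum>p | length p = k + j. \<kappa> * prob {\<omega> \<in> space M. Q (desc (drop j p) \<omega>) \<and> \<tau> (desc p \<omega>)})"
    by (rule sum_mono, rule split_step[OF up ne down split])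
  also have "\<dots> \<le> \<kappa> * (\<kappa> ^ j * (\<Sum>p | length p = k. prob {\<omega> \<in> space M. \<tau> (desc p \<omega>)}))"
    unfolding sum_distrib_left[symmetric] using Suc \<kappa> by (intro mult_left_mono)
  finally show ?case by (simp add: mult.assoc)
qed

text \<open>Passes from centres to data points: points in the two balls are at least
  \<open>\<rho> - 4 * r \<ge> \<rho> / 2\<close> apart. This halves the distance, which turns
  \<open>720\<close> into \<open>1440\<close> and is why \<open>14400\<close> is twice
  \<open>7200\<close>.\<close>

lemma touching_split:
  assumes d: "1 \<le> d" and dbl: "doubling D C d" and ab: "a \<in> vecs D" "b \<in> vecs D"
    and r: "0 < r" "14400 * real d * r \<le> \<rho>" and far: "\<rho> - 2 * r \<le> vdist D a b"
    and T: "T \<subseteq> C" "x \<in> T" "touches D a b r T" and R: "diam_le D T R" "0 < R"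
  shows "measure (split_noise D) {n \<in> space (split_noise D). touches D a b r (split_cell D T x n True)} +
    measure (split_noise D) {n \<in> space (split_noise D). touches D a b r (split_cell D T x n False)} \<le> 1 - \<rho> / (1440 * R)"
proof -
  obtain y y' where y: "y \<in> T \<inter> vball D a r" "y' \<in> T \<inter> vball D b r" using T(3) by (auto simp: touches_def)
  have "1 * r \<le> real d * r" using d r(1) by (intro mult_right_mono) auto
  then have r': "14400 * r \<le> \<rho>" using r(2) by linarith
  have "vdist D a b \<le> vdist D a y + vdist D y y' + vdist D y' b"
    using vdist_triangle[of D a b y] vdist_triangle[of D y b y'] by linarith
  then have yy': "\<rho> / 2 \<le> vdist D y y'"
    using y far r' r(1) by (auto simp: mem_vball vdist_commute[of D y' b])
  have "7200 * real d * r \<le> vdist D y y'" using yy' r(2) by linarith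
  from split_touch[OF D d dbl finite_subset[OF T(1) C_props(2)] T(1,2) ab r(1) y this R(1)]
  have "measure (split_noise D) {n \<in> space (split_noise D). touches D a b r (split_cell D T x n True)} +
    measure (split_noise D) {n \<in> space (split_noise D). touches D a b r (split_cell D T x n False)} \<le> 1 - vdist D y y' / (720 * R)" .
  also have "\<dots> \<le> 1 - \<rho> / 2 / (720 * R)" using yy' R(2) by (intro diff_left_mono divide_right_mono) auto
  finally show ?thesis by simp
qed

text \<open>
  Stating the event through the ancestor \<open>j\<close> levels up makes it possible to bound the failure of
  the second stage without conditioning on the success of the first.
\<close>

lemma stage:
  assumes d: "1 \<le> d" and dbl: "doubling D C d" and R\<^sub>0: "diam_le D C R\<^sub>0" "0 < R\<^sub>0"
    and A: "A \<subseteq> vecs D" "finite A" "C \<subseteq> (\<Union>a\<in>A. vball D a r)"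
    and r: "0 < r" "14400 * real d * r \<le> \<rho>" and R: "0 < R" "\<rho> \<le> R" "R \<le> R\<^sub>0"
  shows "prob {\<omega> \<in> space M. \<exists>p. length p = k + j \<and> diam_le D (desc (drop j p) \<omega>) R \<and> \<not> diam_le D (desc p \<omega>) \<rho>} \<le>
    (real (card A))\<^sup>2 * (1 - \<rho> / (1440 * R)) ^ j"
proof -
  \<comment> \<open>Two points more than \<open>\<rho>\<close> apart lie in covering balls whose
    centres satisfy this bound, so every failure is seen by a pair in \<open>G\<close>.\<close>
  define G where "G = {(a, b) \<in> A \<times> A. \<rho> - 2 * r \<le> vdist D a b}"
  define Ev where "Ev = (\<lambda>(a, b) p. {\<omega> \<in> space M. diam_le D (desc (drop j p) \<omega>) R \<and> touches D a b r (desc p \<omega>)})"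
  have "0 < 14400 * real d * r" using d r(1) by simp
  then have \<rho>: "0 < \<rho>" using r(2) by linarith
  have finG: "finite G" unfolding G_def by (rule finite_subset[of _ "A \<times> A"]) (use A in auto)
  have "card G \<le> card (A \<times> A)" unfolding G_def using A by (intro card_mono) auto
  then have "real (card G) \<le> real (card A * card A)" by (simp only: of_nat_le_iff card_cartesian_product)
  then have cardG: "real (card G) \<le> (real (card A))\<^sup>2" by (simp add: power2_eq_square)
  have \<kappa>: "0 \<le> 1 - \<rho> / (1440 * R')" "1 - \<rho> / (1440 * R') \<le> 1" if "R \<le> R'" for R'
    using that R \<rho> by (auto simp: divide_le_eq)
  have ne: "\<not> touches D a b r {}" for a b by (simp add: touches_def)
  have Ev_meas: "Ev g p \<in> sets M" for g p
  proof -
    have "Ev g p = {\<omega> \<in> space M. diam_le D (desc (drop j p) \<omega>) R} \<inter>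
        {\<omega> \<in> space M. touches D (fst g) (snd g) r (desc p \<omega>)}"
      by (auto simp: Ev_def case_prod_beta)
    then show ?thesis by (simp only:) (intro sets.Int desc_measurable)
  qed
  have pair: "(\<Sum>p | length p = k + j. prob (Ev g p)) \<le> (1 - \<rho> / (1440 * R)) ^ j" if "g \<in> G" for g
  proof -
    obtain a b where g: "g = (a, b)" "a \<in> vecs D" "b \<in> vecs D" "\<rho> - 2 * r \<le> vdist D a b"
      using \<open>g \<in> G\<close> A(1) unfolding G_def by blast
    note split = touching_split[OF d dbl g(2,3) r g(4)]
    \<comment> \<open>Down to level \<open>k\<close> only the trivial bound \<open>R\<^sub>0\<close>
      on diameters is available. It still gives a factor at most \<open>1\<close>, so the expected
      count stays below its value at the root, a single node.\<close>
    have "(\<Sum>p | length p = 0 + k. prob {\<omega> \<in> space M. diam_le D (desc (drop k p) \<omega>) R\<^sub>0 \<and> touches D a b r (desc p \<omega>)}) \<le>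
        (1 - \<rho> / (1440 * R\<^sub>0)) ^ k * (\<Sum>p | length p = 0. prob {\<omega> \<in> space M. touches D a b r (desc p \<omega>)})"
      by (rule expected_count[OF _ ne _ split[OF _ _ _ _ R\<^sub>0(2)] \<kappa>(1)[OF R(3)]])
        (erule (1) touches_subset diam_le_subset)+
    also have "\<dots> \<le> 1 * 1"
      using \<kappa>[OF R(3)] by (intro mult_mono power_le_one) auto
    finally have le1: "(\<Sum>p | length p = k. prob {\<omega> \<in> space M. touches D a b r (desc p \<omega>)}) \<le> 1"
      using diam_le_subset[OF R\<^sub>0(1) desc_subset] by simp
    \<comment> \<open>From level \<open>k\<close> on, the ancestor's bound \<open>R\<close> is
      inherited and gives the geometric decay.\<close>
    have "(\<Sum>p | length p = k + j. prob (Ev g p)) \<le>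
        (1 - \<rho> / (1440 * R)) ^ j * (\<Sum>p | length p = k. prob {\<omega> \<in> space M. touches D a b r (desc p \<omega>)})"
      unfolding Ev_def g(1) prod.case
      by (rule expected_count[OF _ ne _ split[OF _ _ _ _ R(1)] \<kappa>(1)[OF order_refl]])
        (erule (1) touches_subset diam_le_subset)+
    also have "\<dots> \<le> (1 - \<rho> / (1440 * R)) ^ j * 1"
      using \<kappa>(1)[OF order_refl] le1 by (intro mult_left_mono zero_le_power) auto
    finally show ?thesis by simp
  qed
  have "{\<omega> \<in> space M. \<exists>p. length p = k + j \<and> diam_le D (desc (drop j p) \<omega>) R \<and> \<not> diam_le D (desc p \<omega>) \<rho>} \<subseteq>
      (\<Union>g\<in>G. \<Union>p\<in>{p. length p = k + j}. Ev g p)"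
  proof
    fix \<omega> assume "\<omega> \<in> {\<omega> \<in> space M. \<exists>p. length p = k + j \<and> diam_le D (desc (drop j p) \<omega>) R \<and> \<not> diam_le D (desc p \<omega>) \<rho>}"
    then obtain p where p: "\<omega> \<in> space M" "length p = k + j" "diam_le D (desc (drop j p) \<omega>) R" "\<not> diam_le D (desc p \<omega>) \<rho>"
      by auto
    then obtain y z where yz: "y \<in> desc p \<omega>" "z \<in> desc p \<omega>" "\<rho> < vdist D y z" by (auto simp: diam_le_def not_le)
    then obtain a b where ab: "a \<in> A" "y \<in> vball D a r" "b \<in> A" "z \<in> vball D b r"
      using A(3) desc_subset[of p \<omega>] by blast
    have "vdist D y z \<le> vdist D y a + vdist D a b + vdist D b z"
      using vdist_triangle[of D y z a] vdist_triangle[of D a z b] by linarith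
    then have "\<rho> - 2 * r \<le> vdist D a b" using ab yz(3) by (simp add: mem_vball vdist_commute[of D y a])
    then have "(a, b) \<in> G" using ab by (simp add: G_def)
    moreover have "\<omega> \<in> Ev (a, b) p" using p ab yz by (auto simp: Ev_def touches_def)
    ultimately show "\<omega> \<in> (\<Union>g\<in>G. \<Union>p\<in>{p. length p = k + j}. Ev g p)" using p(2) by blast
  qed
  then have "prob {\<omega> \<in> space M. \<exists>p. length p = k + j \<and> diam_le D (desc (drop j p) \<omega>) R \<and> \<not> diam_le D (desc p \<omega>) \<rho>} \<le>
      prob (\<Union>g\<in>G. \<Union>p\<in>{p. length p = k + j}. Ev g p)"
    by (rule finite_measure_mono) (intro sets.finite_UN finG finite_level Ev_meas)
  also have "\<dots> \<le> (\<Sum>g\<in>G. prob (\<Union>p\<in>{p. length p = k + j}. Ev g p))"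
    using finG by (rule finite_measure_subadditive_finite) (auto intro!: sets.finite_UN finite_level Ev_meas)
  also have "\<dots> \<le> (\<Sum>g\<in>G. \<Sum>p | length p = k + j. prob (Ev g p))"
    by (intro sum_mono finite_measure_subadditive_finite finite_level) (auto intro: Ev_meas)
  also have "\<dots> \<le> card G * (1 - \<rho> / (1440 * R)) ^ j"
    using sum_bounded_above[of G "\<lambda>g. \<Sum>p | length p = k + j. prob (Ev g p)"] pair by simp
  also have "\<dots> \<le> (real (card A))\<^sup>2 * (1 - \<rho> / (1440 * R)) ^ j"
    using cardG \<kappa>(1)[OF order_refl] by (intro mult_right_mono zero_le_power) auto
  finally show ?thesis .
qed

end

section \<open>Combining two stages\<close>

text \<open>The squared count is at most \<open>exp (2 * d * m)\<close>, and \<open>K\<close> steps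
  bring a factor \<open>exp (- K * \<epsilon>)\<close>. The surplus \<open>3\<close> leaves
  \<open>exp (- 3) \<le> 1 / 8\<close>, so two stages fail with probability at most
  \<open>1 / 4\<close>.\<close>

lemma union_bound_decay:
  fixes \<epsilon> :: real
  assumes "n \<le> 2 ^ (d * m)" "\<epsilon> \<le> 1" "2 * real d * real m + 3 \<le> real K * \<epsilon>"
  shows "(real n)\<^sup>2 * (1 - \<epsilon>) ^ K \<le> 1 / 8"
proof -
  have e2: "2 \<le> exp (1::real)" using exp_ge_add_one_self[of 1] by simp
  have "real n \<le> real (2 ^ (d * m))" using assms(1) by (simp only: of_nat_le_iff)
  then have "(real n)\<^sup>2 \<le> (2 ^ (d * m))\<^sup>2" by (intro power_mono) auto
  also have "\<dots> = 2 ^ (2 * d * m)" by (simp add: power_mult[symmetric] mult_ac)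
  also have "\<dots> \<le> exp 1 ^ (2 * d * m)" using e2 by (intro power_mono) auto
  also have "\<dots> = exp (2 * real d * real m)" by (simp add: exp_of_nat_mult[symmetric])
  finally have n: "(real n)\<^sup>2 \<le> exp (2 * real d * real m)" .
  have "(1 - \<epsilon>) ^ K \<le> exp (- \<epsilon>) ^ K"
    using assms(2) exp_ge_add_one_self[of "- \<epsilon>"] by (intro power_mono) auto
  also have "\<dots> = exp (- (real K * \<epsilon>))" by (simp add: exp_of_nat_mult[symmetric])
  also have "\<dots> \<le> exp (- (2 * real d * real m + 3))" using assms(3) by simp
  finally have "(real n)\<^sup>2 * (1 - \<epsilon>) ^ K \<le> exp (2 * real d * real m) * exp (- (2 * real d * real m + 3))"
    using n assms(2) by (intro mult_mono) auto
  also have "\<dots> = 1 / exp 1 ^ 3" by (simp add: exp_add[symmetric] exp_minus exp_of_nat_mult[symmetric] field_simps)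
  also have "\<dots> \<le> 1 / 2 ^ 3" using e2 by (intro divide_left_mono power_mono) auto
  finally show ?thesis by simp
qed

lemma real_nat_ceiling_le: "real (nat \<lceil>x\<rceil>) \<le> x + 1" if "0 \<le> x" for x :: real
  using of_int_ceiling_le_add_one[of x] that by simp

lemma half_le_ln: "1 / 2 \<le> ln (real d)" if "2 \<le> d"
proof -
  have "ln 2 \<le> ln (real d)" using that by (subst ln_le_cancel_iff) auto
  then show ?thesis using ln2_ge_two_thirds by linarith
qed

text \<open>\<open>m\<close> is about \<open>log 2 (s * d)\<close>. With only a factor
  \<open>sqrt s\<close> in front, its part \<open>ln s\<close> is absorbed because
  \<open>ln (sqrt s) \<le> sqrt s\<close>; the result is linear in \<open>s\<close> with
  \<open>ln d\<close> alone.\<close>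

lemma cover_depth:
  fixes s :: real and d :: nat
  assumes "2 \<le> d" "2 \<le> s"
  obtains m :: nat where "28800 * s * d \<le> 2 ^ m" "sqrt s * m \<le> 42 * s * ln d"
proof
  let ?x = "28800 * s * real d"
  define m where "m = nat \<lceil>log 2 ?x\<rceil>"
  have x: "1 \<le> ?x" using mult_mono[of 1 s 1 "real d"] assms by simp
  have "?x = 2 powr (log 2 ?x)" using x by simp
  also have "\<dots> \<le> 2 powr (real m)" unfolding m_def by (intro powr_mono real_nat_ceiling_ge) auto
  finally show "28800 * s * d \<le> 2 ^ m" by (simp add: powr_realpow)
  have ln2: "1 / 2 \<le> ln (2::real)" using ln2_ge_two_thirds by simp
  have L: "1 / 2 \<le> ln d" by (rule half_le_ln[OF assms(1)])
  have log2: "log 2 t \<le> 2 * ln t" if "1 \<le> t" for t :: real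
  proof -
    have "ln t * (1 / 2) \<le> ln t * ln 2" using ln2 that by (intro mult_left_mono) auto
    then show ?thesis using ln2 by (simp add: log_def divide_le_eq)
  qed
  have "log 2 28800 \<le> log 2 (2 ^ 15 :: real)" by (subst log_le_cancel_iff) auto
  then have "log 2 28800 \<le> (15::real)" by (simp only: log_pow_cancel)
  moreover have "log 2 ?x = log 2 28800 + log 2 s + log 2 d" using assms by (simp add: log_mult)
  ultimately have "log 2 ?x \<le> 15 + 2 * ln s + 2 * ln d" using log2[of s] log2[of d] assms by simp
  moreover have "real m \<le> log 2 ?x + 1"
    unfolding m_def by (rule real_nat_ceiling_le) (use x in simp)
  \<comment> \<open>The constant \<open>15 + 1\<close> is at most \<open>32 * ln d\<close>, as
    \<open>ln d \<ge> 1 / 2\<close>.\<close>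
  ultimately have "real m \<le> 34 * ln d + 2 * ln s" using L by linarith
  then have "sqrt s * m \<le> sqrt s * (34 * ln d + 2 * ln s)" using assms by (intro mult_left_mono) auto
  also have "\<dots> = 34 * (sqrt s * ln d) + 4 * (sqrt s * ln (sqrt s))"
    using assms by (simp add: ln_sqrt algebra_simps)
  also have "\<dots> \<le> 34 * (s * ln d) + 4 * (s * (2 * ln d))"
  proof (intro add_mono mult_left_mono)
    have "sqrt s \<le> s" using assms real_sqrt_le_mono[of s "s\<^sup>2"] by (simp add: power2_eq_square)
    then show "sqrt s * ln d \<le> s * ln d" using L by (intro mult_right_mono) auto
    have "ln (sqrt s) \<le> sqrt s" using assms ln_le_minus_one[of "sqrt s"] by simp
    then have "sqrt s * ln (sqrt s) \<le> sqrt s * sqrt s" using assms by (intro mult_left_mono) auto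
    also have "\<dots> = s * 1" using assms by simp
    also have "\<dots> \<le> s * (2 * ln d)" using assms L by (intro mult_left_mono) auto
    finally show "sqrt s * ln (sqrt s) \<le> s * (2 * ln d)" .
  qed auto
  finally show "sqrt s * m \<le> 42 * s * ln d" by simp
qed

context rp_subtree
begin

lemma desc_radius_bound:
  assumes d: "2 \<le> d" and dim: "doubling_dim D C \<le> d" and s: "2 \<le> s"
  shows "prob {\<omega> \<in> space M. \<forall>p. real (length p) > 1100000 * s * real d * ln (real d) \<longrightarrow>
    radius D (desc p \<omega>) \<le> radius D C / s} \<ge> 1 - 1 / 4" (is "prob ?G \<ge> _")
proof (cases "radius D C = 0")
  case True
  have "radius D (desc p \<omega>) \<le> radius D C / s" for p \<omega>
    using radius_mono[OF C_props(2,3) desc_subset] True by simp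
  then show ?thesis using prob_space by simp
next
  case False
  define \<Delta> where "\<Delta> = radius D C"
  have \<Delta>: "0 < \<Delta>" using False radius_nonneg[OF C_props(2,3)] by (simp add: \<Delta>_def)
  \<comment> \<open>The factor \<open>2\<close> gives strict slack above the infimum, so its
    attainment need not be shown; it also makes \<open>4 * \<Delta>\<close> the initial
    diameter.\<close>
  obtain c where c: "c \<in> vecs D" "C \<subseteq> vball D c (2 * \<Delta>)"
    using radius_lessD[OF C_props(2,3), of "2 * \<Delta>"] \<Delta> unfolding \<Delta>_def by auto
  have diam: "diam_le D C (4 * \<Delta>)" using diam_le_vball[OF c(2)] by simp
  have dbl: "doubling D C d" using doubling_of_dim_le[OF C_props(2,3) dim] .
  have d1: "1 \<le> d" using d by simp
  obtain m where m: "28800 * s * d \<le> 2 ^ m" "sqrt s * m \<le> 42 * s * ln d"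
    using cover_depth[OF d s] .
  \<comment> \<open>Fine enough for the smaller target \<open>\<Delta> / s\<close>, so the same
    cover serves both stages. \<open>28800\<close> is \<open>14400\<close> times the factor
    \<open>2\<close> in the starting radius.\<close>
  define r where "r = 2 * \<Delta> / 2 ^ m"
  have twice: "0 < 2 * \<Delta>" using \<Delta> by simp
  obtain A where A: "A \<subseteq> vecs D" "finite A" "card A \<le> 2 ^ (d * m)"
    "vball D c (2 * \<Delta>) \<inter> C \<subseteq> (\<Union>a\<in>A. vball D a (2 * \<Delta> / 2 ^ m))"
    using doubling_cover[OF dbl c(1) twice, of m] by (elim exE conjE)
  have cover: "C \<subseteq> (\<Union>a\<in>A. vball D a r)" using A(4) c(2) unfolding r_def by (simp add: Int_absorb1)
  have s1: "1 \<le> sqrt s" "sqrt s * sqrt s = s" "sqrt s \<le> s"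
    using s mult_left_mono[of 1 "sqrt s" "sqrt s"] by auto
  have r: "0 < r" using \<Delta> by (simp add: r_def)
  have r2: "14400 * real d * r \<le> \<Delta> / s"
  proof -
    have "14400 * real d * r = \<Delta> / s * (28800 * s * d / 2 ^ m)" using s by (simp add: r_def)
    also have "\<dots> \<le> \<Delta> / s * 1" using m(1) \<Delta> s by (intro mult_left_mono) (auto simp: divide_le_eq)
    finally show ?thesis by simp
  qed
  have \<rho>: "\<Delta> / s \<le> \<Delta> / sqrt s" "\<Delta> / sqrt s \<le> 4 * \<Delta>"
  proof -
    show "\<Delta> / s \<le> \<Delta> / sqrt s" using \<Delta> s s1(3) by (intro divide_left_mono) auto
    have "\<Delta> / sqrt s \<le> \<Delta> / 1" using \<Delta> s1(1) by (intro divide_left_mono) auto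
    then show "\<Delta> / sqrt s \<le> 4 * \<Delta>" using \<Delta> by simp
  qed
  \<comment> \<open>Stage one shrinks \<open>4 * \<Delta>\<close> to
    \<open>\<Delta> / sqrt s\<close>, a loss of \<open>1 / (5760 * sqrt s)\<close> per level with
    \<open>5760 = 4 * 1440\<close>. Stage two loses more per level, so the same \<open>K\<close>
    suffices.\<close>
  define K where "K = nat \<lceil>5760 * sqrt s * (2 * d * m + 3)\<rceil>"
  have K: "5760 * sqrt s * (2 * real d * real m + 3) \<le> K"
    unfolding K_def by (rule order_trans[OF _ real_nat_ceiling_ge]) simp
  have Km: "(2 * real d * real m + 3) \<le> K * (1 / (5760 * sqrt s))"
    using K s1(1) by (simp add: le_divide_eq mult_ac)
  have le: "real K * (1 / (5760 * sqrt s)) \<le> real K * (1 / (1440 * sqrt s))"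
    using s1(1) by (intro mult_left_mono divide_left_mono) auto
  have eps: "1 / (5760 * sqrt s) \<le> 1" "1 / (1440 * sqrt s) \<le> 1"
    by (subst divide_le_eq_1_pos; use s1(1) in linarith)+
  have ratio: "\<Delta> / (t * t) / (1440 * (\<Delta> / t)) = 1 / (1440 * t)" if "0 < t" for t
    using \<Delta> that by (simp add: field_simps)
  define B\<^sub>1 where "B\<^sub>1 = {\<omega> \<in> space M. \<exists>p. length p = 0 + K \<and> diam_le D (desc (drop K p) \<omega>) (4 * \<Delta>) \<and>
    \<not> diam_le D (desc p \<omega>) (\<Delta> / sqrt s)}"
  define B\<^sub>2 where "B\<^sub>2 = {\<omega> \<in> space M. \<exists>p. length p = K + K \<and> diam_le D (desc (drop K p) \<omega>) (\<Delta> / sqrt s) \<and>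
    \<not> diam_le D (desc p \<omega>) (\<Delta> / s)}"
  have "prob B\<^sub>1 \<le> (real (card A))\<^sup>2 * (1 - \<Delta> / sqrt s / (1440 * (4 * \<Delta>))) ^ K"
    unfolding B\<^sub>1_def using \<Delta> \<rho> r2 by (intro stage[OF d1 dbl diam _ A(1,2) cover r]) auto
  also have "\<Delta> / sqrt s / (1440 * (4 * \<Delta>)) = 1 / (5760 * sqrt s)" using \<Delta> by simp
  also have "(real (card A))\<^sup>2 * (1 - 1 / (5760 * sqrt s)) ^ K \<le> 1 / 8"
    by (rule union_bound_decay[OF A(3) eps(1) Km])
  finally have B1: "prob B\<^sub>1 \<le> 1 / 8" .
  have "prob B\<^sub>2 \<le> (real (card A))\<^sup>2 * (1 - \<Delta> / s / (1440 * (\<Delta> / sqrt s))) ^ K"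
    unfolding B\<^sub>2_def using \<Delta> \<rho> r2 s1(1) by (intro stage[OF d1 dbl diam _ A(1,2) cover r]) auto
  also have "\<Delta> / s / (1440 * (\<Delta> / sqrt s)) = 1 / (1440 * sqrt s)"
    by (rule ratio[of "sqrt s", unfolded s1(2)]) (use s in simp)
  also have "(real (card A))\<^sup>2 * (1 - 1 / (1440 * sqrt s)) ^ K \<le> 1 / 8"
    by (rule union_bound_decay[OF A(3) eps(2) order_trans[OF Km le]])
  finally have B2: "prob B\<^sub>2 \<le> 1 / 8" .
  \<comment> \<open>Origin of the final constant: \<open>2 * 5760 * 87 = 1002240\<close>, and the
    \<open>2\<close> from rounding up twice is at most \<open>s * d * ln d\<close>.\<close>
  have K2: "2 * real K \<le> 1100000 * s * d * ln d"
  proof -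
    have "2 * (1 / 2) \<le> d * ln d" using half_le_ln[OF d] d by (intro mult_mono) auto
    then have "s * 1 \<le> s * (d * ln d)" using s by (intro mult_left_mono) auto
    then have sdl: "s \<le> s * d * ln d" by simp
    have "sqrt s * (2 * d * m + 3) = 2 * d * (sqrt s * m) + 3 * sqrt s" by (simp add: algebra_simps)
    also have "\<dots> \<le> 2 * d * (42 * s * ln d) + 3 * s"
      using m(2) s1(3) by (intro add_mono mult_left_mono) auto
    also have "\<dots> = 84 * (s * d * ln d) + 3 * s" by simp
    finally have *: "sqrt s * (2 * d * m + 3) \<le> 87 * (s * d * ln d)" using sdl by linarith
    have "0 \<le> sqrt s * (2 * d * m + 3)" using s by simp
    then have "real K \<le> 5760 * (sqrt s * (2 * d * m + 3)) + 1"
      unfolding K_def mult.assoc by (intro real_nat_ceiling_le) simp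
    then have "2 * real K \<le> 1100000 * (s * d * ln d)" using * sdl s by linarith
    then show ?thesis by simp
  qed
  have meas: "?G \<in> sets M" "B\<^sub>1 \<in> sets M" "B\<^sub>2 \<in> sets M"
    unfolding B\<^sub>1_def B\<^sub>2_def
    by (intro sets.sets_Collect_countable_All sets.sets_Collect_countable_Ex sets.sets_Collect_imp
        sets.sets_Collect_conj sets.sets_Collect_neg sets.sets_Collect_const desc_measurable)+
  have "space M - ?G \<subseteq> B\<^sub>1 \<union> B\<^sub>2"
  proof (rule subsetI, rule ccontr)
    fix \<omega> assume \<omega>: "\<omega> \<in> space M - ?G" "\<omega> \<notin> B\<^sub>1 \<union> B\<^sub>2"
    have "radius D (desc p \<omega>) \<le> radius D C / s" if p: "real (length p) > 1100000 * s * real d * ln (real d)" for p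
    proof -
      \<comment> \<open>The last turn comes first in a node, so this is the ancestor of
        \<open>p\<close> exactly \<open>2 * K\<close> levels below \<open>q\<close>; its diameter
        bound passes down to \<open>p\<close>.\<close>
      define p' where "p' = drop (length p - 2 * K) p"
      have "2 * real K < real (length p)" using K2 p by linarith
      then have len: "length p' = K + K" unfolding p'_def by simp
      \<comment> \<open>Outside \<open>B\<^sub>1\<close> and \<open>B\<^sub>2\<close> the two stages
        chain: \<open>drop K p'\<close> lies at level \<open>K\<close>, and dropping
        \<open>K\<close> more turns reaches \<open>C\<close> itself.\<close>
      have "diam_le D (desc (drop K (drop K p')) \<omega>) (4 * \<Delta>)"
        using diam_le_subset[OF diam desc_subset] .
      then have "diam_le D (desc (drop K p') \<omega>) (\<Delta> / sqrt s)"
        using \<omega> len unfolding B\<^sub>1_def by auto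
      then have "diam_le D (desc p' \<omega>) (\<Delta> / s)"
        using \<omega> len unfolding B\<^sub>2_def by auto
      then have "diam_le D (desc p \<omega>) (\<Delta> / s)"
        by (rule diam_le_subset) (simp add: p'_def desc_drop_subset)
      then show ?thesis
        using radius_le_diam[of "desc p \<omega>" D "\<Delta> / s"] desc_subset C_props(3) \<Delta> s by (auto simp: \<Delta>_def)
    qed
    then show False using \<omega>(1) by blast
  qed
  then have "prob (space M - ?G) \<le> prob (B\<^sub>1 \<union> B\<^sub>2)"
    by (rule finite_measure_mono) (intro sets.Un meas)
  also have "\<dots> \<le> prob B\<^sub>1 + prob B\<^sub>2" by (intro measure_Un_le meas)
  finally show ?thesis using B1 B2 prob_compl[OF meas(1)] by linarith
qed

end

text \<open>The bound holds for every frozen outcome \<open>\<omega>\<^sub>0\<close> outside the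
  subtree, hence conditionally on how \<open>C\<close> arose. The choice \<open>2 \<le> d\<close>
  keeps the factor \<open>ln d\<close> positive.\<close>

theorem theorem1:
  "\<exists>c\<^sub>2 > 0. \<forall>(D::nat) (S::vec set) (pick::pick_rule) (q::node) (\<omega>\<^sub>0::node \<Rightarrow> noise) (C::vec set) (d::nat) (s::real).
     1 \<le> D \<and> finite S \<and> S \<subseteq> vecs D \<and> valid_pick D S pick \<and>
     \<omega>\<^sub>0 \<in> space (tree_noise D (- subtree q)) \<and> C = cell D S pick \<omega>\<^sub>0 q \<and>
     2 \<le> d \<and> doubling_dim D C \<le> d \<and> 2 \<le> s \<longrightarrow>
     measure (tree_noise D (subtree q))
       {\<omega> \<in> space (tree_noise D (subtree q)).
          \<forall>p. real (length p) > c\<^sub>2 * s * real d * ln (real d) \<longrightarrow>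
            radius D (cell D S pick (override_on \<omega>\<^sub>0 \<omega> (subtree q)) (p @ q)) \<le> radius D C / s}
       \<ge> 1 - 1 / 4"
proof (intro exI[of _ "1100000::real"] conjI allI impI; (elim conjE)?)
  fix D S pick q \<omega>\<^sub>0 C d and s :: real
  assume *: "1 \<le> D" "finite S" "S \<subseteq> vecs D" "valid_pick D S pick" "\<omega>\<^sub>0 \<in> space (tree_noise D (- subtree q))"
    and C: "C = cell D S pick \<omega>\<^sub>0 q" and d: "2 \<le> d" "doubling_dim D C \<le> d" and s: "2 \<le> s"
  interpret rp_subtree D S pick q \<omega>\<^sub>0 using * by unfold_locales
  show "1 - 1 / 4 \<le> measure (tree_noise D (subtree q))
       {\<omega> \<in> space (tree_noise D (subtree q)).
          \<forall>p. real (length p) > 1100000 * s * real d * ln (real d) \<longrightarrow>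
            radius D (cell D S pick (override_on \<omega>\<^sub>0 \<omega> (subtree q)) (p @ q)) \<le> radius D C / s}"
    using desc_radius_bound[OF d(1) d(2)[unfolded C] s] unfolding C desc_def .
qed simp

end
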